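(* For each integer $m\ge 0$ there exist a simple polar-to-neighborly $4$-dimensional polytope $Q_m\subset\mathbb{R}^4$ with $n=m+5$ facets and a linear objective function $f:\mathbb{R}^4\to\mathbb{R}$ such that the orientation induced by $f$ on the $1$-skeleton of $Q_m$ admits a monotone Hamilton path, i.e. there is a path along edges of $Q_m$ that visits every vertex of $Q_m$ exactly once and along which $f$ is strictly increasing. Therefore, for all $n\ge 5$, $$M(4,n)\;=\;M_{\rm ubt}(4,n)\;=\;\tfrac12\,n(n-3).$$
   Context: Polytopes are convex polytopes. A $d$-dimensional polytope is simple if every vertex lies in exactly $d$ facets. A simple $d$-polytope is polar-to-neighborly if its polar is a neighborly polytope, i.e. any at most $\lfloor d/2\rfloor$ of its facets have nonempty common intersection. For $n>d\ge 2$, $M(d,n)$ denotes the maximal number of vertices that can lie on a monotone path on a $d$-dimensional polytope with $n$ facets, i.e. on a path along edges that is strictly increasing with respect to some linear objective function (the maximum is over all $d$-polytopes with $n$ facets, all linear objective functions, and all such paths). $M_{\rm ubt}(d,n)$ denotes the maximal number of vertices that a $d$-dimensional polytope with $n$ facets can have; by the Upper Bound Theorem it is attained by the polars of cyclic $d$-polytopes with $n$ vertices. *)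

theory Defs
  imports "HOL-Analysis.Analysis"
begin

definition vertices :: "'a::euclidean_space set \<Rightarrow> 'a set"
  where "vertices P = {v. v extreme_point_of P}"

definition facets :: "'a::euclidean_space set \<Rightarrow> 'a set set"
  where "facets P = {F. F facet_of P}"

definition simple_polytope :: "'a::euclidean_space set \<Rightarrow> bool"
  where "simple_polytope P \<longleftrightarrow>
    polytope P \<and> (\<forall>v \<in> vertices P. int (card {F \<in> facets P. v \<in> F}) = aff_dim P)"

definition polar_to_neighborly :: "'a::euclidean_space set \<Rightarrow> bool"
  where "polar_to_neighborly P \<longleftrightarrow>
    simple_polytope P \<and>
    (\<forall>S \<subseteq> facets P. int (card S) \<le> aff_dim P div 2 \<longrightarrow> \<Inter>S \<noteq> {})"

text \<open>Paths are given by the list of the vertices they visit.\<close>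

definition edge_path :: "'a::euclidean_space set \<Rightarrow> 'a list \<Rightarrow> bool"
  where "edge_path P vs \<longleftrightarrow>
    vs \<noteq> [] \<and> set vs \<subseteq> vertices P \<and>
    successively (\<lambda>x y. closed_segment x y edge_of P) vs"

definition monotone_path :: "'a::euclidean_space set \<Rightarrow> ('a \<Rightarrow> real) \<Rightarrow> 'a list \<Rightarrow> bool"
  where "monotone_path P f vs \<longleftrightarrow> edge_path P vs \<and> successively (\<lambda>x y. f x < f y) vs"

definition monotone_hamilton_path ::
    "'a::euclidean_space set \<Rightarrow> ('a \<Rightarrow> real) \<Rightarrow> 'a list \<Rightarrow> bool"
  where "monotone_hamilton_path P f vs \<longleftrightarrow>
    monotone_path P f vs \<and> distinct vs \<and> set vs = vertices P"

text \<open>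
  The dimension $d$ is the cardinality of the index type \<^typ>\<open>'d\<close>, and $d$-polytopes are
  taken to be the full-dimensional polytopes in $d$-space; so $M(4,n)$ is
  \<open>M_mono TYPE(4) n\<close>. Both maxima range over finite sets
  (\<open>finite_vertex_numbers\<close> and \<open>finite_monotone_path_lengths\<close> below).
\<close>

definition d_polytopes :: "'d::finite itself \<Rightarrow> nat \<Rightarrow> (real^'d) set set"
  where "d_polytopes _ n =
    {P. polytope P \<and> aff_dim P = int CARD('d) \<and> card (facets P) = n}"

definition M_mono :: "'d::finite itself \<Rightarrow> nat \<Rightarrow> nat"
  where "M_mono d n =
    Max {length vs | P f vs. P \<in> d_polytopes d n \<and> linear f \<and> monotone_path P f vs}"

definition M_ubt :: "'d::finite itself \<Rightarrow> nat \<Rightarrow> nat"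
  where "M_ubt d n = Max {card (vertices P) | P. P \<in> d_polytopes d n}"

lemma finite_facets: "polytope P \<Longrightarrow> finite (facets P)"
  by (simp add: facets_def finite_polytope_facets)

lemma finite_vertices: "polytope P \<Longrightarrow> finite (vertices P)"
  by (simp add: vertices_def finite_polyhedron_extreme_points polytope_imp_polyhedron)

lemma card_vertices_le:
  fixes d :: "'d::finite itself"
  assumes "P \<in> d_polytopes d n"
  shows "card (vertices P) \<le> 2 ^ n"
proof -
  let ?I = "\<lambda>v. {F \<in> facets P. v \<in> F}"
  have P: "polytope P" "aff_dim P = int CARD('d)" "card (facets P) = n"
    using assms by (auto simp: d_polytopes_def)
  have eq: "{v} = \<Inter>(?I v)" if "v \<in> vertices P" for v
  proof -
    have "{v} face_of P"
      using that by (simp add: vertices_def face_of_singleton)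
    moreover have "{v} \<noteq> P"
      using P(2) by auto
    ultimately have "{v} = \<Inter>{F. F facet_of P \<and> {v} \<subseteq> F}"
      by (intro face_of_polyhedron polytope_imp_polyhedron P(1)) auto
    then show ?thesis
      by (simp add: facets_def)
  qed
  have "inj_on ?I (vertices P)"
    proof (rule inj_onI)
    fix v w assume vw: "v \<in> vertices P" "w \<in> vertices P" "?I v = ?I w"
    have "{v} = \<Inter>(?I v)" by (rule eq[OF vw(1)])
    also have "\<dots> = \<Inter>(?I w)" by (simp only: vw(3))
    also have "\<dots> = {w}" by (rule eq[OF vw(2), symmetric])
    finally show "v = w" by simp
  qed
  moreover have "?I ` vertices P \<subseteq> Pow (facets P)"
    by auto
  ultimately have "card (vertices P) \<le> card (Pow (facets P))"
    by (rule card_inj_on_le) (simp add: finite_facets P(1))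
  then show ?thesis
    by (simp add: card_Pow finite_facets P)
qed

lemma finite_vertex_numbers: "finite {card (vertices P) | P. P \<in> d_polytopes d n}"
  by (rule finite_subset[of _ "{..2 ^ n}"]) (auto simp: card_vertices_le)

lemma monotone_path_distinct: "monotone_path P f vs \<Longrightarrow> distinct vs"
proof -
  assume "monotone_path P f vs"
  then have "successively (\<lambda>x y. f x < f y) vs"
    by (simp add: monotone_path_def)
  then have "sorted_wrt (\<lambda>x y. f x < f y) vs"
    by (subst (asm) successively_conv_sorted_wrt) (auto simp: transp_def)
  then show "distinct vs"
    by (induction vs) auto
qed

lemma finite_monotone_path_lengths:
  "finite {length vs | P f vs. P \<in> d_polytopes d n \<and> linear f \<and> monotone_path P f vs}"
proof -
  have "length vs \<le> 2 ^ n" if "P \<in> d_polytopes d n" "monotone_path P f vs" for P f vs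
  proof -
    have "length vs = card (set vs)"
      by (simp add: distinct_card monotone_path_distinct[OF that(2)])
    also have "\<dots> \<le> card (vertices P)"
      using that by (intro card_mono finite_vertices)
        (auto simp: d_polytopes_def monotone_path_def edge_path_def)
    also have "\<dots> \<le> 2 ^ n"
      by (rule card_vertices_le[OF that(1)])
    finally show ?thesis .
  qed
  then show ?thesis
    by - (rule finite_subset[of _ "{..2 ^ n}"], auto)
qed

end

theory Submission
  imports Defs
begin

text \<open>
  Both halves of the theorem rest on an upper bound and a construction that meets it.

  \<^bold>\<open>Upper bound.\<close> If $f_k$ denotes the number of $k$-dimensional faces of a 4-polytope, Euler's relation
  says $f_0 - f_1 + f_2 - f_3 = 0$. Every vertex lies on at least four edges and every edge has two
  vertices, so $f_1 \ge 2 f_0$; every 2-face is the intersection of two facets, so $f_2$ is at most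
  the number of pairs of facets that meet. Hence $f_0 + f_3 \le {f_3 \choose 2}$, that is
  $f_0 \le \frac12 n (n - 3)$ for $n = f_3$
  (\<open>vertices_4_polytope_le\<close>). Euler's relation comes from a more general statement
  (\<open>euler_partition\<close>): if a compact convex set is cut into finitely many relatively open
  convex pieces, the signs \<open>(-1)^dim\<close> of the pieces add up to 1. This is proved by slicing with
  parallel hyperplanes, which reduces the dimension and turns each piece into an open interval or a point.

  \<^bold>\<open>Construction.\<close> Start from a simplex and cut repeatedly, dualising Shemer's sewing. The locale
  \<open>sewing\<close> describes a 4-polytope with $n = r + 3$ facets together with a polygonal 2-face $A$
  whose vertices are $w$ and $x_0, \dots, x_{r-1}$, and an increasing edge path $L$
  through $\frac12 n (n - 3)$ vertices. A new halfspace cuts off $x_0, \dots, x_{r-1}$ but keeps $w$ and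
  everything else. Its bounding hyperplane is a slight tilt of one that supports the polytope in $A$, so
  each $x_i$ is replaced by two vertices $\alpha_i, \beta_i$ near $x_i$ on the two edges
  $x_i y_i$, $x_i z_i$ that leave $A$, and two vertices $p_0, p_1$ appear on the edges
  from $w$ to $x_0$ and to $x_{r-1}$. That is $r + 2$ additional vertices for one additional facet,
  exactly the increase of $\frac12 n (n - 3)$.

  The path is repaired locally. If it runs through $x_i$ from $y_i$ to $z_i$, it now runs
  $y_i, \alpha_i, \beta_i, z_i$, and monotonicity is automatic because $\alpha_i$ lies between $y_i$ and $x_i$ and
  $\beta_i$ between $x_i$ and $z_i$; only in the simplex, where the path ends in a vertex of $A$, the
  order of $\alpha_i$ and $\beta_i$ has to be arranged. The one exceptional stretch is $w, x_{r-1}, y_{r-1}$, where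
  the path follows an edge of $A$; it becomes $w, p_0, p_1, \beta_{r-1}, \alpha_{r-1}, y_{r-1}$, and
  the tilt is chosen so that $p_0$ comes before $p_1$. The new 2-face with vertices $p_0$, all
  $\alpha_i$ and $p_1$, with $p_0$ in the role of $w$ and $p_1$ in that of the last $x$, is again in the same
  position, so the step can be iterated (\<open>sewing_next\<close>).

  \<^bold>\<open>Conclusion.\<close> Only the vertices on the path are ever tracked. The upper bound shows that there are no
  others, that there are exactly $n$ facets, and, since equality forces every pair of facets to
  meet, that the polytope is polar-to-neighborly (\<open>extremal\<close>).
\<close>

section \<open>The Euler characteristic of convex partitions\<close>

lemma aff_dim_nonneg_iff: "0 \<le> aff_dim S \<longleftrightarrow> S \<noteq> {}"
  by (metis aff_dim_negative_iff not_le)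

text \<open>Relative openness is what keeps the dimension count exact: a hyperplane that meets a relatively
  open set without containing it lowers the dimension by precisely one.\<close>

lemma rel_open_slice:
  fixes F :: "'a::euclidean_space set"
  assumes F: "convex F" "rel_open F" and ne: "F \<inter> {x. u \<bullet> x = t} \<noteq> {}"
  shows "rel_open (F \<inter> {x. u \<bullet> x = t})"
    and "aff_dim (F \<inter> {x. u \<bullet> x = t}) =
          (if F \<subseteq> {x. u \<bullet> x = t} then aff_dim F else aff_dim F - 1)"
proof -
  let ?H = "{x. u \<bullet> x = t}"
  have aff: "affine ?H" by (rule affine_hyperplane)
  show "rel_open (F \<inter> ?H)"
    using convex_affine_rel_interior_Int[OF F(1) aff] F(2) ne by (simp add: rel_open_def)
  have aS: "affine (affine hull F \<inter> ?H)" by (simp add: affine_Int aff)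
  then have hS: "affine hull (affine hull F \<inter> ?H) = affine hull F \<inter> ?H"
    by (rule affine_hull_eq[THEN iffD2])
  have "openin (top_of_set (affine hull F)) F"
    using F(2) rel_open by blast
  then have "openin (top_of_set (affine hull F \<inter> ?H)) (F \<inter> ?H)"
    unfolding openin_open by blast
  then have "affine hull ((affine hull F \<inter> ?H) \<inter> (F \<inter> ?H)) = affine hull F \<inter> ?H"
    by (subst affine_hull_convex_Int_openin)
      (use aS ne hull_subset[of F affine] in \<open>auto simp: affine_imp_convex hS\<close>)
  moreover have "(affine hull F \<inter> ?H) \<inter> (F \<inter> ?H) = F \<inter> ?H"
    using hull_subset[of F affine] by blast
  ultimately have "aff_dim (F \<inter> ?H) = aff_dim (affine hull F \<inter> ?H)"
    by (metis aff_dim_affine_hull)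
  also have "\<dots> = (if affine hull F \<subseteq> ?H then aff_dim F else aff_dim F - 1)"
    using ne hull_subset[of F affine]
    by (subst aff_dim_affine_Int_hyperplane) auto
  also have "affine hull F \<subseteq> ?H \<longleftrightarrow> F \<subseteq> ?H"
    by (rule subset_hull) (rule aff)
  finally show "aff_dim (F \<inter> ?H) = (if F \<subseteq> ?H then aff_dim F else aff_dim F - 1)" .
qed

lemma rel_open_image_inner:
  fixes F :: "'a::euclidean_space set"
  assumes F: "convex F" "rel_open F" "bounded F" and pq: "p \<in> F" "q \<in> F" "u \<bullet> p \<noteq> u \<bullet> q"
  obtains a b where "a < b" "(\<lambda>x. u \<bullet> x) ` F = {a<..<b}"
proof -
  let ?f = "\<lambda>x. u \<bullet> x"
  have lin: "linear ?f" by (simp add: bounded_linear.linear bounded_linear_inner_right)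
  have cI: "convex (?f ` F)" using lin F(1) by (rule convex_linear_image)
  have bI: "bounded (?f ` F)" using F(3) lin by (simp add: bounded_linear_image linear_linear)
  have "connected (closure (?f ` F))" "compact (closure (?f ` F))"
    using cI bI by (auto simp: convex_connected connected_imp_connected_closure)
  then obtain a b where ab: "closure (?f ` F) = {a..b}"
    using connected_compact_interval_1 by blast
  have "?f p \<in> {a..b}" "?f q \<in> {a..b}"
    using ab pq closure_subset[of "?f ` F"] by auto
  then have "a < b" using pq(3) by auto
  have "?f ` F = rel_interior (?f ` F)"
    using rel_interior_convex_linear_image[OF lin F(1)] F(2) by (simp add: rel_open_def)
  also have "\<dots> = rel_interior (closure (?f ` F))"
    using convex_rel_interior_closure[OF cI] by simp
  also have "\<dots> = {a<..<b}"
    using ab \<open>a < b\<close> by simp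
  finally show ?thesis using that \<open>a < b\<close> by blast
qed

text \<open>The Euler characteristic with compact support of a relatively open convex set, so that
  it is additive over partitions.\<close>

definition euler_char :: "'a::euclidean_space set \<Rightarrow> int"
  where "euler_char F = (if F = {} then 0 else (- 1) ^ nat (aff_dim F))"

lemma euler_char_slice:
  assumes F: "convex F" "rel_open F" and "p \<in> F" "q \<in> F" "u \<bullet> p \<noteq> u \<bullet> q" and "t \<in> (\<lambda>x. u \<bullet> x) ` F"
  shows "euler_char (F \<inter> {x. u \<bullet> x = t}) = - euler_char F"
proof -
  have ne: "F \<inter> {x. u \<bullet> x = t} \<noteq> {}" using assms(6) by auto
  moreover have "\<not> F \<subseteq> {x. u \<bullet> x = t}" using assms(3-5) by blast
  ultimately have d: "aff_dim (F \<inter> {x. u \<bullet> x = t}) = aff_dim F - 1"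
    using rel_open_slice(2)[OF F ne] by simp
  moreover have "aff_dim (F \<inter> {x. u \<bullet> x = t}) \<ge> 0"
    using ne by (simp add: aff_dim_nonneg_iff)
  ultimately have "nat (aff_dim F) = Suc (nat (aff_dim (F \<inter> {x. u \<bullet> x = t})))"
    by simp
  then show ?thesis using ne assms by (auto simp: euler_char_def)
qed

text \<open>A single offset that moves every element of \<open>T\<close> off \<open>T\<close> but not past the next element replaces
  the one-sided limits in the next proof.\<close>

lemma uniform_gap:
  fixes T :: "real set"
  assumes "finite T"
  obtains e where "e > 0" "\<And>s t. \<lbrakk>s \<in> T; t \<in> T; t < s\<rbrakk> \<Longrightarrow> t + e < s"
proof -
  let ?D = "insert 1 ((\<lambda>(s, t). s - t) ` {(s, t) \<in> T \<times> T. t < s})"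
  have fin: "finite ?D"
    using assms by (auto intro: finite_subset[of _ "T \<times> T"])
  then have pos: "Min ?D > 0" by (subst Min_gr_iff) auto
  have "Min ?D \<le> s - t" if "s \<in> T" "t \<in> T" "t < s" for s t
    using that by (intro Min_le fin) force
  then show ?thesis using that[of "Min ?D / 2"] pos by fastforce
qed

text \<open>Slice by the level sets $H_t$ of a linear functional that is not constant on \<open>P\<close>. By
  induction on the dimension the slices of the pieces at height $t$ have total characteristic 1 if
  $H_t$ meets \<open>P\<close> and 0 otherwise. The characteristic of a single piece is recovered from its
  slices: the function $g(t)$ that gives the characteristic of the slice at $t$ is a multiple of
  the indicator of a point or of an open interval, and summing the jumps $g(t) - g(t+)$ over all
  endpoints gives the characteristic of the piece. The same sum applied to the indicator of the
  closed interval of heights of \<open>P\<close> gives 1, from the jump at its upper end.\<close>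

proposition euler_partition:
  fixes P :: "'a::euclidean_space set" and F :: "'i \<Rightarrow> 'a set"
  assumes "compact P" "convex P" "P \<noteq> {}" "finite I" "P = (\<Union>i\<in>I. F i)" "disjoint_family_on F I"
    and "\<And>i. i \<in> I \<Longrightarrow> convex (F i) \<and> rel_open (F i)"
  shows "(\<Sum>i\<in>I. euler_char (F i)) = 1"
  using assms
proof (induction "nat (aff_dim P)" arbitrary: P F rule: less_induct)
  case less
  note P = less.prems
  show ?case
  proof (cases "\<exists>a. P = {a}")
    case True
    then obtain a where a: "P = {a}" by blast
    then obtain j where j: "j \<in> I" "a \<in> F j" using P(5) by blast
    have Fj: "F j = {a}" using j P(5) a by blast
    have "F i = {}" if "i \<in> I" "i \<noteq> j" for i
    proof -
      have "F i \<inter> F j = {}" using disjoint_family_onD[OF P(6) that(1) j(1) that(2)] .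
      moreover have "F i \<subseteq> {a}" using P(5) a that(1) by blast
      ultimately show ?thesis using Fj by blast
    qed
    then have "(\<Sum>i\<in>I. euler_char (F i)) = (\<Sum>i\<in>I. if i = j then 1 else 0)"
      by (intro sum.cong) (auto simp: euler_char_def Fj)
    then show ?thesis using j P(4) by simp
  next
    case False
    then obtain p q where pq: "p \<in> P" "q \<in> P" "p \<noteq> q" using P(3) by blast
    define u where "u = q - p"
    let ?H = "\<lambda>t. {x. u \<bullet> x = t}"
    let ?f = "\<lambda>x. u \<bullet> x"
    have u: "u \<bullet> p \<noteq> u \<bullet> q"
      using pq by (metis eq_iff_diff_eq_0 inner_diff_right inner_eq_zero_iff u_def)
    have lin: "linear ?f" by (simp add: bounded_linear.linear bounded_linear_inner_right)
    have "compact (?f ` P)" using P(1) by (intro compact_continuous_image continuous_intros)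
    moreover have "connected (?f ` P)"
      using convex_linear_image[OF lin P(2)] by (rule convex_connected)
    ultimately have "\<exists>\<alpha> \<beta>. ?f ` P = {\<alpha>..\<beta>}" by (simp flip: connected_compact_interval_1)
    then obtain \<alpha> \<beta> where AB: "?f ` P = {\<alpha>..\<beta>}" by blast
    have slice: "(\<Sum>i\<in>I. euler_char (F i \<inter> ?H t)) = (if \<alpha> \<le> t \<and> t \<le> \<beta> then 1 else 0)" for t
    proof (cases "\<alpha> \<le> t \<and> t \<le> \<beta>")
      case True
      then have "t \<in> ?f ` P" using AB by simp
      then have ne: "P \<inter> ?H t \<noteq> {}" by auto
      have "aff_dim (P \<inter> ?H t) \<le> aff_dim (affine hull P \<inter> ?H t)"
        by (intro aff_dim_subset Int_mono hull_subset order_refl)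
      also have "\<dots> < aff_dim P"
      proof -
        have "p \<in> affine hull P" "q \<in> affine hull P" using pq by (simp_all add: hull_inc)
        then have "\<not> affine hull P \<subseteq> ?H t" using u by blast
        moreover have "0 \<le> aff_dim P" using P(3) by (simp add: aff_dim_nonneg_iff)
        ultimately show ?thesis by (simp add: aff_dim_affine_Int_hyperplane)
      qed
      finally have "nat (aff_dim (P \<inter> ?H t)) < nat (aff_dim P)"
        using aff_dim_nonneg_iff[of "P \<inter> ?H t"] ne by linarith
      then have "(\<Sum>i\<in>I. euler_char (F i \<inter> ?H t)) = 1"
      proof (rule less.hyps)
        show "compact (P \<inter> ?H t)" using P(1) by (simp add: compact_Int_closed closed_hyperplane)
        show "convex (P \<inter> ?H t)" using P(2) by (simp add: convex_Int convex_hyperplane)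
        show "P \<inter> ?H t = (\<Union>i\<in>I. F i \<inter> ?H t)" using P(5) by blast
        show "disjoint_family_on (\<lambda>i. F i \<inter> ?H t) I"
          using disjoint_family_onD[OF P(6)] by (fastforce simp: disjoint_family_on_def)
        show "convex (F i \<inter> ?H t) \<and> rel_open (F i \<inter> ?H t)" if "i \<in> I" for i
        proof (cases "F i \<inter> ?H t = {}")
          case False
          then show ?thesis
            using P(7)[OF that] rel_open_slice(1)[of "F i" u t] by (auto simp: convex_Int convex_hyperplane)
        qed (simp add: rel_open_def)
      qed (use ne P(4) in auto)
      then show ?thesis using True by simp
    next
      case False
      then have "t \<notin> ?f ` P" using AB by auto
      then have "\<forall>i\<in>I. F i \<inter> ?H t = {}" using P(5) by auto
      then show ?thesis using False by (auto simp: euler_char_def)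
    qed
    define steps where "steps i T \<longleftrightarrow> finite T \<and> (\<forall>R e. finite R \<longrightarrow> T \<subseteq> R \<longrightarrow> e > 0 \<longrightarrow>
        (\<forall>s\<in>R. \<forall>t\<in>R. t < s \<longrightarrow> t + e < s) \<longrightarrow>
        euler_char (F i) = (\<Sum>t\<in>R. euler_char (F i \<inter> ?H t) - euler_char (F i \<inter> ?H (t + e))))" for i T
    have "\<exists>T. steps i T"
      if i: "i \<in> I" for i
    proof -
      have Fi: "convex (F i)" "rel_open (F i)" "bounded (F i)"
        using P(7)[OF i] P(1,5) i by (auto intro: bounded_subset compact_imp_bounded)
      consider (empty) "F i = {}" | (const) c where "F i \<noteq> {}" "\<forall>x\<in>F i. u \<bullet> x = c"
        | (var) x y where "x \<in> F i" "y \<in> F i" "u \<bullet> x \<noteq> u \<bullet> y" by blast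
      then show ?thesis
      proof cases
        case empty
        then show ?thesis by (intro exI[of _ "{}"]) (auto simp: euler_char_def steps_def)
      next
        case const
        have g: "euler_char (F i \<inter> ?H t) = (if t = c then euler_char (F i) else 0)" for t
        proof (cases "t = c")
          case True
          then have "F i \<inter> ?H t = F i" using const(2) by auto
          then show ?thesis using True by simp
        next
          case False
          then have "F i \<inter> ?H t = {}" using const(2) by auto
          then show ?thesis using False by (simp add: euler_char_def)
        qed
        have "euler_char (F i) = (\<Sum>t\<in>R. euler_char (F i \<inter> ?H t) - euler_char (F i \<inter> ?H (t + e)))"
          if R: "finite R" "{c} \<subseteq> R" "e > 0" "\<forall>s\<in>R. \<forall>t\<in>R. t < s \<longrightarrow> t + e < s" for R e
        proof -
          have "t + e \<noteq> c" if "t \<in> R" for t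
            using R that by (smt (verit) insert_subset)
          then have "(\<Sum>t\<in>R. euler_char (F i \<inter> ?H t) - euler_char (F i \<inter> ?H (t + e)))
            = (\<Sum>t\<in>R. if t = c then euler_char (F i) else 0)"
            by (intro sum.cong) (auto simp: g)
          then show ?thesis using R by simp
        qed
        then show ?thesis by (intro exI[of _ "{c}"]) (auto simp: steps_def)
      next
        case var
        obtain a b where ab: "a < b" "?f ` F i = {a<..<b}"
          using rel_open_image_inner[OF Fi var] by blast
        have g: "euler_char (F i \<inter> ?H t) = (if a < t \<and> t < b then - euler_char (F i) else 0)" for t
        proof (cases "a < t \<and> t < b")
          case True
          then have "t \<in> ?f ` F i" using ab by simp
          then show ?thesis using euler_char_slice[OF Fi(1,2) var] True by simp
        next
          case False
          then have "t \<notin> ?f ` F i" using ab by auto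
          then have "F i \<inter> ?H t = {}" by auto
          then show ?thesis using False by (simp add: euler_char_def)
        qed
        have "euler_char (F i) = (\<Sum>t\<in>R. euler_char (F i \<inter> ?H t) - euler_char (F i \<inter> ?H (t + e)))"
          if R: "finite R" "{a, b} \<subseteq> R" "e > 0" "\<forall>s\<in>R. \<forall>t\<in>R. t < s \<longrightarrow> t + e < s" for R e
        proof -
          have "a < t + e \<longleftrightarrow> a \<le> t" "t + e < b \<longleftrightarrow> t < b" if "t \<in> R" for t
            using R that by (smt (verit) insert_subset)+
          then have "(\<Sum>t\<in>R. euler_char (F i \<inter> ?H t) - euler_char (F i \<inter> ?H (t + e)))
            = (\<Sum>t\<in>R. if t = a then euler_char (F i) else 0)"
            using ab(1) by (intro sum.cong) (auto simp: g)
          then show ?thesis using R by simp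
        qed
        then show ?thesis by (intro exI[of _ "{a, b}"]) (auto simp: steps_def)
      qed
    qed
    then obtain T where T: "\<And>i. i \<in> I \<Longrightarrow> steps i (T i)" by metis
    \<comment> \<open>A common set of jump heights for all pieces and for \<open>P\<close>, so that the sums can be exchanged.\<close>
    define R where "R = {\<alpha>, \<beta>} \<union> (\<Union>i\<in>I. T i)"
    have R: "finite R" "\<And>i. i \<in> I \<Longrightarrow> T i \<subseteq> R"
      using T P(4) by (auto simp: R_def steps_def)
    obtain e where e: "e > 0" "\<And>s t. \<lbrakk>s \<in> R; t \<in> R; t < s\<rbrakk> \<Longrightarrow> t + e < s"
      using uniform_gap[OF R(1)] by blast
    have "\<alpha> \<le> \<beta>" using AB P(3) by (metis atLeastatMost_empty_iff2 image_is_empty)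
    have "(\<Sum>i\<in>I. euler_char (F i)) =
        (\<Sum>i\<in>I. \<Sum>t\<in>R. euler_char (F i \<inter> ?H t) - euler_char (F i \<inter> ?H (t + e)))"
    proof (intro sum.cong refl)
      fix i assume i: "i \<in> I"
      have "\<forall>s\<in>R. \<forall>t\<in>R. t < s \<longrightarrow> t + e < s" using e(2) by blast
      with T[OF i] R(1) R(2)[OF i] e(1)
      show "euler_char (F i) = (\<Sum>t\<in>R. euler_char (F i \<inter> ?H t) - euler_char (F i \<inter> ?H (t + e)))"
        unfolding steps_def by blast
    qed
    also have "\<dots> = (\<Sum>t\<in>R. (\<Sum>i\<in>I. euler_char (F i \<inter> ?H t)) - (\<Sum>i\<in>I. euler_char (F i \<inter> ?H (t + e))))"
      by (subst sum.swap) (simp add: sum_subtractf)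
    also have "\<dots> = (\<Sum>t\<in>R. if t = \<beta> then 1 else 0)"
    proof (intro sum.cong refl)
      fix t assume t: "t \<in> R"
      have ab: "\<alpha> \<in> R" "\<beta> \<in> R" by (auto simp: R_def)
      have "\<alpha> \<le> t + e \<longleftrightarrow> \<alpha> \<le> t" "t + e \<le> \<beta> \<longleftrightarrow> t < \<beta>"
        using e(2)[OF ab(1) t] e(2)[OF ab(2) t] e(1) by linarith+
      then show "(\<Sum>i\<in>I. euler_char (F i \<inter> ?H t)) - (\<Sum>i\<in>I. euler_char (F i \<inter> ?H (t + e))) =
          (if t = \<beta> then 1 else 0)"
        using \<open>\<alpha> \<le> \<beta>\<close> by (simp add: slice)
    qed
    also have "\<dots> = 1" using R(1) by (simp add: R_def)
    finally show ?thesis .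
  qed
qed

section \<open>Euler's relation for polytopes\<close>

text \<open>A point lies in the relative interior of the smallest face that contains it, as otherwise it
  would lie on a facet of that face.\<close>

lemma Union_rel_interior_faces:
  fixes P :: "'a::euclidean_space set"
  assumes P: "polytope P"
  shows "(\<Union>F\<in>{F. F face_of P}. rel_interior F) = P"
proof
  show "(\<Union>F\<in>{F. F face_of P}. rel_interior F) \<subseteq> P"
    using rel_interior_subset face_of_imp_subset by blast
  show "P \<subseteq> (\<Union>F\<in>{F. F face_of P}. rel_interior F)"
  proof
    fix x assume x: "x \<in> P"
    let ?C = "{F. F face_of P \<and> x \<in> F}"
    have "P \<in> ?C" using x P by (simp add: face_of_refl polytope_imp_convex)
    then have G: "\<Inter>?C face_of P" by (intro face_of_Inter) auto
    then have "polyhedron (\<Inter>?C)"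
      using P face_of_polyhedron_polyhedron polytope_imp_polyhedron by blast
    moreover have "x \<in> \<Inter>?C" by blast
    moreover have "\<not> (\<exists>F. F facet_of \<Inter>?C \<and> x \<in> F)"
    proof
      assume "\<exists>F. F facet_of \<Inter>?C \<and> x \<in> F"
      then obtain F where F: "F facet_of \<Inter>?C" "x \<in> F" by blast
      then have "F face_of P" using G facet_of_imp_face_of face_of_trans by blast
      then have "F = \<Inter>?C" using F facet_of_imp_subset by blast
      then show False using F(1) by (metis facet_of_irrefl)
    qed
    ultimately have "x \<in> rel_interior (\<Inter>?C)"
      using rel_boundary_of_polyhedron[of "\<Inter>?C"] by blast
    then show "x \<in> (\<Union>F\<in>{F. F face_of P}. rel_interior F)" using G by blast
  qed
qed

proposition euler_polytope:
  fixes P :: "'a::euclidean_space set"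
  assumes P: "polytope P" "P \<noteq> {}"
  shows "(\<Sum>F | F face_of P. euler_char F) = 1"
proof -
  have conv: "convex F" if "F face_of P" for F using that face_of_imp_convex by blast
  have "euler_char (rel_interior F) = euler_char F" if "F face_of P" for F
    using conv[OF that] rel_interior_eq_empty[of F] rel_interior_same_affine_hull[of F]
    by (metis aff_dim_affine_hull euler_char_def)
  then have "(\<Sum>F | F face_of P. euler_char F) = (\<Sum>F | F face_of P. euler_char (rel_interior F))"
    by simp
  also have "\<dots> = 1"
  proof (rule euler_partition[of P])
    show "finite {F. F face_of P}" by (rule finite_polytope_faces[OF P(1)])
    show "disjoint_family_on rel_interior {F. F face_of P}"
      unfolding disjoint_family_on_def using face_of_eq by blast
    show "convex (rel_interior F) \<and> rel_open (rel_interior F)" if "F \<in> {F. F face_of P}" for F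
      using conv[of F] that by (simp add: convex_rel_interior rel_interior_rel_open)
  qed (use P in \<open>auto simp: polytope_imp_compact polytope_imp_convex Union_rel_interior_faces\<close>)
  finally show ?thesis .
qed

section \<open>Facets and edges at a vertex\<close>

lemma facet_avoiding_set:
  fixes P :: "'a::euclidean_space set"
  assumes P: "polytope P" and C: "C face_of P" "C \<noteq> {}" "C \<noteq> P" and S: "\<not> S \<subseteq> C"
  obtains F where "F facet_of P" "C \<subseteq> F" "\<not> S \<subseteq> F"
proof -
  have eq: "C = \<Inter>{F. F facet_of P \<and> C \<subseteq> F}"
    by (rule face_of_polyhedron[OF polytope_imp_polyhedron[OF P] C])
  obtain x where x: "x \<in> S" "x \<notin> C" using S by blast
  then have "x \<notin> \<Inter>{F. F facet_of P \<and> C \<subseteq> F}" using eq by simp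
  then show ?thesis using that x(1) by blast
qed

text \<open>\<open>G \<inter> G'\<close> is a proper face of \<open>G\<close> that contains the facet \<open>E\<close> of \<open>G\<close>, so it has no room to be
  larger than \<open>E\<close>.\<close>

lemma ridge_eq_Int_facets:
  fixes P :: "'a::euclidean_space set"
  assumes P: "polytope P" and G: "G facet_of P" and E: "E facet_of G"
  obtains G' where "G' facet_of P" "G' \<noteq> G" "E = G \<inter> G'"
proof -
  have EP: "E face_of P" using E G facet_of_imp_face_of face_of_trans by blast
  have dims: "aff_dim E = aff_dim P - 2" "aff_dim G = aff_dim P - 1" "E \<noteq> {}"
    using E G by (auto simp: facet_of_def)
  then have "E \<noteq> P" by auto
  moreover have "\<not> G \<subseteq> E"
    using dims E facet_of_imp_subset by (metis facet_of_irrefl subset_antisym)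
  ultimately obtain G' where G': "G' facet_of P" "E \<subseteq> G'" "\<not> G \<subseteq> G'"
    using facet_avoiding_set[OF P EP dims(3)] by blast
  have face: "(G \<inter> G') face_of P" using G G' by (simp add: face_of_Int facet_of_imp_face_of)
  have GG: "(G \<inter> G') face_of G"
    by (rule face_of_subset[OF face]) (use G facet_of_imp_subset in blast)+
  have "E \<subseteq> G \<inter> G'" using G' E facet_of_imp_subset by blast
  have "E face_of (G \<inter> G')"
    by (rule face_of_subset[OF EP]) (use \<open>E \<subseteq> G \<inter> G'\<close> G facet_of_imp_subset in blast)+
  have "convex G" using G facet_of_imp_face_of face_of_imp_convex by blast
  have "aff_dim (G \<inter> G') < aff_dim G"
    using GG G' by (intro face_of_aff_dim_lt) (auto simp: \<open>convex G\<close>)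
  then have "\<not> aff_dim E < aff_dim (G \<inter> G')" using dims by simp
  then have "E = G \<inter> G'"
    using face_of_aff_dim_lt[OF _ \<open>E face_of (G \<inter> G')\<close>] face_of_imp_convex[OF face] by blast
  then show ?thesis using that G' by blast
qed

lemma facet_at_vertex:
  fixes P :: "'a::euclidean_space set"
  assumes P: "polytope P" and v: "v extreme_point_of P" and d: "aff_dim P > 0"
  obtains F where "F facet_of P" "v \<in> F"
proof -
  have "{v} face_of P" using v by (simp add: face_of_singleton)
  moreover have "{v} \<noteq> P" using d by auto
  ultimately show ?thesis
    using face_of_polyhedron_subset_facet[OF polytope_imp_polyhedron[OF P]] that by blast
qed

text \<open>Induction through a facet \<open>G\<close> at \<open>v\<close>: the facets of \<open>G\<close> at \<open>v\<close> are cut out by other facets of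
  \<open>P\<close> at \<open>v\<close>, distinct ones by distinct ones, and \<open>G\<close> itself is one more.\<close>

lemma card_facets_at_vertex_ge:
  fixes P :: "'a::euclidean_space set"
  assumes "polytope P" and "v extreme_point_of P"
  shows "aff_dim P \<le> int (card {F. F facet_of P \<and> v \<in> F})"
  using assms
proof (induction "nat (aff_dim P)" arbitrary: P rule: less_induct)
  case less
  note P = less.prems
  show ?case
  proof (cases "aff_dim P > 0")
    case False
    then show ?thesis by linarith
  next
    case True
    then obtain G where G: "G facet_of P" "v \<in> G" using facet_at_vertex P by blast
    let ?R = "{E. E facet_of G \<and> v \<in> E}" and ?S = "{F. F facet_of P \<and> v \<in> F}"
    have GP: "polytope G" "v extreme_point_of G"
      using G P extreme_point_of_face[OF facet_of_imp_face_of[OF G(1)]]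
      by (auto intro: facet_of_imp_face_of face_of_polytope_polytope)
    have dG: "aff_dim G = aff_dim P - 1" using G by (simp add: facet_of_def)
    then have IH: "aff_dim G \<le> int (card ?R)" using True GP by (intro less.hyps) auto
    have "?R \<subseteq> (\<lambda>G'. G \<inter> G') ` (?S - {G})"
    proof
      fix E assume E: "E \<in> ?R"
      then obtain G' where "G' facet_of P" "G' \<noteq> G" "E = G \<inter> G'"
        using ridge_eq_Int_facets[OF P(1) G(1)] by blast
      then show "E \<in> (\<lambda>G'. G \<inter> G') ` (?S - {G})" using E by blast
    qed
    moreover have fin: "finite ?S" using finite_polytope_facets[OF P(1)] by simp
    ultimately have "card ?R \<le> card (?S - {G})" by (intro surj_card_le) auto
    also have "\<dots> = card ?S - 1" using G fin by (simp add: card_Diff_singleton)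
    finally have "card ?R \<le> card ?S - 1" .
    moreover have "card ?S > 0" using G fin by (auto simp: card_gt_0_iff)
    ultimately show ?thesis using IH dG by linarith
  qed
qed

text \<open>The edges at a vertex span the whole polytope. In dimension at least 2 there are two different
  facets at \<open>v\<close>; by induction their edges at \<open>v\<close> span two different hyperplanes of the affine hull
  of \<open>P\<close>, which together span everything.\<close>

lemma edges_at_vertex_span:
  fixes P :: "'a::euclidean_space set"
  assumes "polytope P" and "v extreme_point_of P"
  shows "aff_dim (insert v (\<Union>{e. e edge_of P \<and> v \<in> e})) = aff_dim P"
  using assms
proof (induction "nat (aff_dim P)" arbitrary: P rule: less_induct)
  case less
  note P = less.prems
  let ?U = "\<lambda>Q. insert v (\<Union>{e. e edge_of Q \<and> v \<in> e})"
  have vP: "v \<in> P" using P(2) by (simp add: extreme_point_of_def)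
  have cP: "convex P" using P(1) by (rule polytope_imp_convex)
  have UP: "?U P \<subseteq> P" using vP edge_of_imp_subset by blast
  have "aff_dim P \<ge> 0" using vP by (auto simp: aff_dim_nonneg_iff)
  then consider "aff_dim P = 0" | "aff_dim P = 1" | "aff_dim P \<ge> 2" by linarith
  then show ?case
  proof cases
    case 1
    then have "P = {v}" using vP by (metis aff_dim_eq_0 singletonD)
    then have "?U P = {v}" using UP by blast
    then show ?thesis using 1 by (simp only: aff_dim_sing)
  next
    case 2
    then have "P edge_of P" using cP by (simp add: edge_of_def face_of_refl)
    then have "?U P = P" using UP vP by blast
    then show ?thesis by simp
  next
    case 3
    have IH: "?U F \<subseteq> ?U P \<and> affine hull (?U F) = affine hull F"
      if F: "F facet_of P" "v \<in> F" for F
    proof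
      have FP: "F face_of P" "F \<subseteq> P" using F by (auto simp: facet_of_imp_face_of facet_of_imp_subset)
      then show "?U F \<subseteq> ?U P" using face_of_trans unfolding edge_of_def by blast
      have poly: "polytope F" and ext: "v extreme_point_of F"
        using F P extreme_point_of_face[OF facet_of_imp_face_of[OF F(1)]]
        by (auto intro: facet_of_imp_face_of face_of_polytope_polytope)
      have "aff_dim F = aff_dim P - 1" using F by (simp add: facet_of_def)
      then have "aff_dim (?U F) = aff_dim F"
        using poly ext 3 by (intro less.hyps) auto
      moreover have "?U F \<subseteq> F" using F(2) edge_of_imp_subset by blast
      ultimately show "affine hull (?U F) = affine hull F"
        using aff_dim_eq_full_gen by blast
    qed
    obtain F where F: "F facet_of P" "v \<in> F" using facet_at_vertex P 3 by (metis zero_less_numeral less_le_trans)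
    have dF: "aff_dim F = aff_dim P - 1" using F by (simp add: facet_of_def)
    have "{v} face_of P" "{v} \<noteq> P" using P 3 by (auto simp: face_of_singleton)
    moreover have "\<not> F \<subseteq> {v}"
    proof
      assume "F \<subseteq> {v}"
      then have "F = {v}" using F(2) by blast
      then show False using dF 3 by simp
    qed
    ultimately obtain G where "G facet_of P" "{v} \<subseteq> G" "\<not> F \<subseteq> G"
      using facet_avoiding_set[OF P(1)] by blast
    then have G: "G facet_of P" "v \<in> G" "\<not> F \<subseteq> G" by auto
    have dG: "aff_dim G = aff_dim P - 1" using G by (simp add: facet_of_def)
    show ?thesis
    proof (rule ccontr)
      assume "aff_dim (?U P) \<noteq> aff_dim P"
      then have lt: "aff_dim (?U P) \<le> aff_dim P - 1" using aff_dim_subset[OF UP] by linarith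
      have "affine hull H = affine hull (?U P)" if H: "H facet_of P" "v \<in> H" for H
      proof -
        have "aff_dim (?U H) = aff_dim P - 1"
          using IH[OF H] H(1) by (metis aff_dim_affine_hull facet_of_def)
        then have "aff_dim (?U H) = aff_dim (?U P)"
          using lt aff_dim_subset[of "?U H" "?U P"] IH[OF H] by linarith
        then show ?thesis using aff_dim_eq_full_gen IH[OF H] by metis
      qed
      then have "affine hull F = affine hull G" using F G by metis
      then have "F = G"
        using face_of_imp_eq_affine_Int[OF cP facet_of_imp_face_of[OF F(1)]]
          face_of_imp_eq_affine_Int[OF cP facet_of_imp_face_of[OF G(1)]] by simp
      then show False using G by simp
    qed
  qed
qed

lemma edge_eq_segment:
  fixes P :: "'a::euclidean_space set"
  assumes P: "polytope P" and e: "e edge_of P"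
  obtains a b where "e = closed_segment a b"
proof -
  have "polytope e" using e P face_of_polytope_polytope by (auto simp: edge_of_def)
  moreover have "collinear e" using e by (simp add: collinear_aff_dim edge_of_def)
  moreover have "e \<noteq> {}" using e by (auto simp: edge_of_def)
  ultimately show ?thesis
    using that compact_convex_collinear_segment polytope_imp_compact polytope_imp_convex by metis
qed

lemma edge_at_vertex_eq_segment:
  fixes P :: "'a::euclidean_space set"
  assumes P: "polytope P" and e: "e edge_of P" and v: "v extreme_point_of P" "v \<in> e"
  obtains b where "e = closed_segment v b"
proof -
  obtain a b where ab: "e = closed_segment a b" using edge_eq_segment[OF P e] .
  have "v extreme_point_of e" using v e extreme_point_of_face[of e P] by (simp add: edge_of_def)
  then have "v = a \<or> v = b" using ab extreme_point_of_segment by blast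
  then show ?thesis using ab that closed_segment_commute by metis
qed

lemma finite_edges: "polytope P \<Longrightarrow> finite {e. e edge_of P \<and> Q e}"
  by (rule finite_subset[OF _ finite_polytope_faces]) (auto simp: edge_of_def)

lemma card_edges_at_vertex_ge:
  fixes P :: "'a::euclidean_space set"
  assumes P: "polytope P" and v: "v extreme_point_of P"
  shows "aff_dim P \<le> int (card {e. e edge_of P \<and> v \<in> e})"
proof -
  let ?E = "{e. e edge_of P \<and> v \<in> e}"
  have fin: "finite ?E" by (rule finite_edges[OF P])
  have "\<forall>e\<in>?E. \<exists>b. e = closed_segment v b"
    using edge_at_vertex_eq_segment[OF P _ v] by blast
  then obtain b where b: "\<And>e. e \<in> ?E \<Longrightarrow> e = closed_segment v (b e)"
    using bchoice by metis
  have "insert v (\<Union>?E) \<subseteq> affine hull (insert v (b ` ?E))"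
  proof
    fix x assume x: "x \<in> insert v (\<Union>?E)"
    show "x \<in> affine hull (insert v (b ` ?E))"
    proof (cases "x = v")
      case True
      then show ?thesis by (simp add: hull_inc)
    next
      case False
      then obtain e where e: "e \<in> ?E" "x \<in> e" using x by blast
      then have "x \<in> convex hull {v, b e}" using b by (metis segment_convex_hull)
      also have "\<dots> \<subseteq> affine hull {v, b e}" by (rule convex_hull_subset_affine_hull)
      also have "\<dots> \<subseteq> affine hull (insert v (b ` ?E))" using e by (intro hull_mono) auto
      finally show ?thesis .
    qed
  qed
  then have "aff_dim P \<le> aff_dim (insert v (b ` ?E))"
    using aff_dim_subset edges_at_vertex_span[OF P v] by (metis aff_dim_affine_hull)
  also have "\<dots> \<le> int (card (insert v (b ` ?E))) - 1"
    using fin by (intro aff_dim_le_card) auto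
  also have "\<dots> \<le> int (card ?E)"
    using card_insert_le_m1[of "card ?E + 1" "b ` ?E" v] card_image_le[OF fin, of b] by linarith
  finally show ?thesis .
qed

lemma card_vertices_of_edge_le:
  fixes P :: "'a::euclidean_space set"
  assumes P: "polytope P" and e: "e edge_of P"
  shows "card {v \<in> vertices P. v \<in> e} \<le> 2"
proof -
  obtain a b where ab: "e = closed_segment a b" using edge_eq_segment[OF P e] .
  have "{v \<in> vertices P. v \<in> e} \<subseteq> {a, b}"
    using extreme_point_of_face[of e P] e ab extreme_point_of_segment
    unfolding edge_of_def vertices_def by blast
  then have "card {v \<in> vertices P. v \<in> e} \<le> card {a, b}" by (intro card_mono) auto
  then show ?thesis using card_insert_le_m1[of 2 "{b}" a] by simp
qed

lemma ridges_subset: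
  fixes P :: "'a::euclidean_space set"
  assumes P: "polytope P"
  shows "{E. E face_of P \<and> E \<noteq> {} \<and> aff_dim E = aff_dim P - 2} \<subseteq>
    Inter ` {S. S \<subseteq> facets P \<and> card S = 2 \<and> \<Inter>S \<noteq> {}}"
proof
  fix E assume E: "E \<in> {E. E face_of P \<and> E \<noteq> {} \<and> aff_dim E = aff_dim P - 2}"
  then have "E \<noteq> P" by auto
  then obtain G where G: "G facet_of P" "E \<subseteq> G"
    using face_of_polyhedron_subset_facet[OF polytope_imp_polyhedron[OF P]] E by blast
  have "E face_of G"
    by (rule face_of_subset[of E P]) (use E G facet_of_imp_subset in auto)
  then have "E facet_of G" using E G by (simp add: facet_of_def)
  then obtain G' where "G' facet_of P" "G' \<noteq> G" "E = G \<inter> G'"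
    using ridge_eq_Int_facets[OF P G(1)] by blast
  then show "E \<in> Inter ` {S. S \<subseteq> facets P \<and> card S = 2 \<and> \<Inter>S \<noteq> {}}"
    using G E by (intro image_eqI[of _ _ "{G, G'}"]) (auto simp: facets_def)
qed

section \<open>The upper bound in dimension four\<close>

definition face_number :: "'a::euclidean_space set \<Rightarrow> nat \<Rightarrow> nat"
  where "face_number P k = card {F. F face_of P \<and> aff_dim F = int k}"

lemma euler_4_polytope:
  fixes P :: "'a::euclidean_space set"
  assumes P: "polytope P" and d: "aff_dim P = 4"
  shows "int (face_number P 0) + int (face_number P 2) = int (face_number P 1) + int (face_number P 3)"
proof -
  let ?F = "\<lambda>k. {F. F face_of P \<and> aff_dim F = int k}"
  have fin: "finite {F. F face_of P}" by (rule finite_polytope_faces[OF P])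
  have ne: "P \<noteq> {}" using d by auto
  have U: "{F. F face_of P} = insert {} (\<Union>k\<in>{..4}. ?F k)"
  proof (intro equalityI subsetI)
    fix F assume F: "F \<in> {F. F face_of P}"
    show "F \<in> insert {} (\<Union>k\<in>{..4}. ?F k)"
    proof (cases "F = {}")
      case False
      then have "0 \<le> aff_dim F" "aff_dim F \<le> 4"
        using F d aff_dim_subset[of F P] by (auto simp: aff_dim_nonneg_iff face_of_imp_subset)
      then show ?thesis using F by (intro insertI2 UN_I[of "nat (aff_dim F)"]) auto
    qed simp
  qed auto
  have "1 = (\<Sum>F\<in>insert {} (\<Union>k\<in>{..4}. ?F k). euler_char F)"
    using euler_polytope[OF P ne] U by simp
  also have "\<dots> = (\<Sum>F\<in>(\<Union>k\<in>{..4}. ?F k). euler_char F)"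
    by (subst sum.insert_if) (use fin U in \<open>auto simp: euler_char_def intro: finite_subset\<close>)
  also have "\<dots> = (\<Sum>k\<in>{..4}. \<Sum>F\<in>?F k. euler_char F)"
    by (rule sum.UNION_disjoint) (auto intro: finite_subset[OF _ fin])
  also have "\<dots> = (\<Sum>k\<in>{..4::nat}. (- 1) ^ k * int (face_number P k))"
  proof (intro sum.cong refl)
    fix k :: nat assume "k \<in> {..4}"
    have "(\<Sum>F\<in>?F k. euler_char F) = (\<Sum>F\<in>?F k. (- 1) ^ k)"
      by (intro sum.cong refl) (auto simp: euler_char_def)
    then show "(\<Sum>F\<in>?F k. euler_char F) = (- 1) ^ k * int (face_number P k)"
      by (simp add: face_number_def)
  qed
  also have "\<dots> = int (face_number P 0) - face_number P 1 + face_number P 2 - face_number P 3 + face_number P 4"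
    by (simp add: eval_nat_numeral)
  also have "face_number P 4 = 1"
  proof -
    have "?F 4 = {P}"
    proof (intro equalityI subsetI)
      fix F assume F: "F \<in> ?F 4"
      then show "F \<in> {P}"
        using face_of_aff_dim_lt[of P F] polytope_imp_convex[OF P] d by fastforce
    qed (use d P in \<open>auto simp: face_of_refl polytope_imp_convex\<close>)
    then show ?thesis by (simp add: face_number_def)
  qed
  finally show ?thesis by simp
qed

lemma face_number_0: "face_number P 0 = card (vertices P)"
proof -
  have "{F. F face_of P \<and> aff_dim F = int 0} = (\<lambda>v. {v}) ` vertices P"
    by (auto simp: aff_dim_eq_0 vertices_def face_of_singleton)
  then show ?thesis by (simp add: face_number_def card_image)
qed

text \<open>The bound is stated with the pairs of facets that actually meet, since the case of equality is
  what later yields neighborliness.\<close>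

theorem vertices_4_polytope_le:
  fixes P :: "'a::euclidean_space set"
  assumes P: "polytope P" and d: "aff_dim P = 4"
  shows "card (vertices P) + card (facets P) \<le> card {S. S \<subseteq> facets P \<and> card S = 2 \<and> \<Inter>S \<noteq> {}}"
proof -
  let ?E = "{e. e edge_of P}"
  have finV: "finite (vertices P)" and finF: "finite (facets P)"
    using P by (auto simp: finite_vertices finite_facets)
  have finE: "finite ?E" using finite_edges[OF P, of "\<lambda>_. True"] by simp
  have "4 * card (vertices P) = (\<Sum>v\<in>vertices P. 4)" by simp
  also have "\<dots> \<le> (\<Sum>v\<in>vertices P. card {e \<in> ?E. v \<in> e})"
  proof (rule sum_mono)
    fix v assume "v \<in> vertices P"
    then show "4 \<le> card {e \<in> ?E. v \<in> e}"
      using card_edges_at_vertex_ge[OF P, of v] d by (simp add: vertices_def)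
  qed
  also have "\<dots> = (\<Sum>e\<in>?E. card {v \<in> vertices P. v \<in> e})"
    using sum_multicount_gen[OF finV finE, of "\<lambda>v e. v \<in> e" "\<lambda>e. card {v \<in> vertices P. v \<in> e}"] by simp
  also have "\<dots> \<le> (\<Sum>e\<in>?E. 2)"
    by (intro sum_mono card_vertices_of_edge_le[OF P]) auto
  also have "\<dots> = 2 * face_number P 1"
    by (simp add: face_number_def edge_of_def)
  finally have 1: "2 * card (vertices P) \<le> face_number P 1" by simp
  have "facets P = {F. F face_of P \<and> aff_dim F = int 3}"
    using d by (auto simp: facets_def facet_of_def)
  then have 3: "face_number P 3 = card (facets P)" by (simp add: face_number_def)
  have "{F. F face_of P \<and> aff_dim F = int 2} \<subseteq> Inter ` {S. S \<subseteq> facets P \<and> card S = 2 \<and> \<Inter>S \<noteq> {}}"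
    using ridges_subset[OF P] d by force
  moreover have "finite {S. S \<subseteq> facets P \<and> card S = 2 \<and> \<Inter>S \<noteq> {}}"
    by (rule finite_subset[of _ "Pow (facets P)"]) (use finF in auto)
  ultimately have "face_number P 2 \<le> card {S. S \<subseteq> facets P \<and> card S = 2 \<and> \<Inter>S \<noteq> {}}"
    unfolding face_number_def by (intro surj_card_le) auto
  then show ?thesis
    using euler_4_polytope[OF P d] 1 3 by (simp add: face_number_0)
qed

corollary vertices_4_polytope_le_ubt:
  fixes P :: "'a::euclidean_space set"
  assumes P: "polytope P" and d: "aff_dim P = 4"
  shows "2 * int (card (vertices P)) \<le> int (card (facets P)) * (int (card (facets P)) - 3)"
proof -
  let ?n = "card (facets P)"
  have "card {S. S \<subseteq> facets P \<and> card S = 2 \<and> \<Inter>S \<noteq> {}} \<le> card {S. S \<subseteq> facets P \<and> card S = 2}"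
    by (rule card_mono) (auto intro: finite_subset[of _ "Pow (facets P)"] simp: finite_facets P)
  also have "\<dots> = ?n choose 2" by (rule n_subsets) (simp add: finite_facets P)
  finally have "card (vertices P) + ?n \<le> ?n choose 2"
    using vertices_4_polytope_le[OF P d] by linarith
  moreover have "2 * int (?n choose 2) = int ?n * (int ?n - 1)"
  proof -
    have "even (?n * (?n - 1))" by auto
    then have "2 * (?n choose 2) = ?n * (?n - 1)" unfolding choose_two by (rule dvd_mult_div_cancel)
    then have "int (2 * (?n choose 2)) = int (?n * (?n - 1))" by simp
    then show ?thesis by (cases ?n) (auto simp: algebra_simps)
  qed
  ultimately show ?thesis by (simp add: algebra_simps)
qed

section \<open>Cutting a polytope by a halfspace\<close>

lemma vertices_iff_face: "v \<in> vertices P \<longleftrightarrow> {v} face_of P"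
  by (simp add: vertices_def face_of_singleton)

lemma closed_segment_edge_imp_vertices:
  assumes "closed_segment u v edge_of P"
  shows "u \<in> vertices P" "v \<in> vertices P"
  using assms segment_face_of[of u v P] by (auto simp: edge_of_def vertices_def)

lemma aff_dim_closed_segment:
  fixes u v :: "'a::euclidean_space"
  assumes "u \<noteq> v"
  shows "aff_dim (closed_segment u v) = 1"
  using assms by (metis aff_dim_2 aff_dim_convex_hull segment_convex_hull)

text \<open>For an affine \<open>h\<close>, the zero of \<open>h\<close> between points \<open>u\<close> and \<open>v\<close> where its signs differ.\<close>

definition crossing :: "('a::real_vector \<Rightarrow> real) \<Rightarrow> 'a \<Rightarrow> 'a \<Rightarrow> 'a"
  where "crossing h u v = u + (h u / (h u - h v)) *\<^sub>R (v - u)"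

lemma crossing_param:
  assumes "h u < 0" "0 < h v"
  obtains t where "0 < t" "t < 1" "crossing h u v = (1 - t) *\<^sub>R u + t *\<^sub>R v" "t = h u / (h u - h v)"
proof -
  let ?t = "h u / (h u - h v)"
  have "0 < ?t" "?t < 1" using assms by (auto simp: divide_simps)
  then show ?thesis using that[of ?t] by (simp add: crossing_def algebra_simps)
qed

lemma crossing_between:
  fixes q :: "'a::euclidean_space"
  assumes "h u < 0" "0 < h v"
  shows "q \<bullet> u < q \<bullet> v \<Longrightarrow> q \<bullet> u < q \<bullet> crossing h u v \<and> q \<bullet> crossing h u v < q \<bullet> v"
    and "q \<bullet> v < q \<bullet> u \<Longrightarrow> q \<bullet> v < q \<bullet> crossing h u v \<and> q \<bullet> crossing h u v < q \<bullet> u"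
proof -
  obtain t where t: "0 < t" "t < 1" "crossing h u v = (1 - t) *\<^sub>R u + t *\<^sub>R v"
    using crossing_param[of h u v] assms by blast
  have 1: "q \<bullet> crossing h u v = q \<bullet> u + t * (q \<bullet> v - q \<bullet> u)"
    "q \<bullet> crossing h u v = q \<bullet> v - (1 - t) * (q \<bullet> v - q \<bullet> u)"
    by (simp_all add: t(3) inner_add_right algebra_simps)
  show "q \<bullet> u < q \<bullet> crossing h u v \<and> q \<bullet> crossing h u v < q \<bullet> v" if "q \<bullet> u < q \<bullet> v"
    using 1 t that by (metis add_less_same_cancel1 diff_gt_0_iff_gt less_add_same_cancel1
        diff_less_eq mult_pos_pos)
  show "q \<bullet> v < q \<bullet> crossing h u v \<and> q \<bullet> crossing h u v < q \<bullet> u" if "q \<bullet> v < q \<bullet> u"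
  proof -
    have "t * (q \<bullet> v - q \<bullet> u) < 0" "(1 - t) * (q \<bullet> v - q \<bullet> u) < 0"
      using t that by (simp_all add: mult_pos_neg)
    then show ?thesis using 1 by linarith
  qed
qed

lemma crossing_open_segment:
  assumes "h u < 0" "0 < h v"
  shows "crossing h u v \<in> open_segment u v"
proof -
  obtain t where "0 < t" "t < 1" "crossing h u v = (1 - t) *\<^sub>R u + t *\<^sub>R v"
    using crossing_param[of h u v] assms by blast
  moreover have "u \<noteq> v" using assms by auto
  ultimately show ?thesis by (auto simp: in_segment)
qed

locale cut =
  fixes P :: "'a::euclidean_space set" and a :: 'a and b :: real
  assumes polytope_P: "polytope P"
begin

definition h :: "'a \<Rightarrow> real" where "h x = a \<bullet> x - b"

definition pos :: "'a set" where "pos = {x. 0 \<le> h x}"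

definition hyp :: "'a set" where "hyp = {x. h x = 0}"

definition Q :: "'a set" where "Q = P \<inter> pos"

abbreviation cr :: "'a \<Rightarrow> 'a \<Rightarrow> 'a" where "cr \<equiv> crossing h"

lemma pos_eq: "pos = {x. b \<le> a \<bullet> x}" and hyp_eq: "hyp = {x. a \<bullet> x = b}"
  by (auto simp: pos_def hyp_def h_def)

lemma convex_P: "convex P" by (rule polytope_imp_convex[OF polytope_P])

lemma convex_pos: "convex pos" by (simp add: pos_eq convex_halfspace_ge)

lemma polytope_Q: "polytope Q"
  unfolding Q_def pos_eq by (rule polytope_Int_polyhedron[OF polytope_P polyhedron_halfspace_ge])

lemma h_convex_comb: "h ((1 - t) *\<^sub>R u + t *\<^sub>R v) = (1 - t) * h u + t * h v"
  by (simp add: h_def inner_add_right algebra_simps)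

lemma h_crossing [simp]: "h u < 0 \<Longrightarrow> 0 < h v \<Longrightarrow> h (cr u v) = 0"
proof -
  assume uv: "h u < 0" "0 < h v"
  obtain t where t: "cr u v = (1 - t) *\<^sub>R u + t *\<^sub>R v" "t = h u / (h u - h v)"
    using crossing_param[of h u v] uv by blast
  have "t * (h u - h v) = h u" using uv t(2) by simp
  then show "h (cr u v) = 0" unfolding t(1) h_convex_comb by (simp add: algebra_simps)
qed

lemma cr_in_segment:
  assumes "h u < 0" "0 < h v"
  shows "cr u v \<in> open_segment u v" "cr u v \<in> closed_segment u v"
  using crossing_open_segment[of h u v] assms open_closed_segment by auto

lemma face_pos: "G face_of P \<Longrightarrow> (G \<inter> pos) face_of Q"
  unfolding Q_def by (rule face_of_slice[OF _ convex_pos])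

lemma face_hyp:
  assumes "G face_of P"
  shows "(G \<inter> hyp) face_of Q"
proof -
  have "hyp face_of pos" unfolding hyp_eq pos_eq by (rule hyperplane_face_of_halfspace_ge)
  then show ?thesis unfolding Q_def by (rule face_of_Int_Int[OF assms])
qed

lemma aff_dim_hyp:
  assumes "G face_of P" "x \<in> G" "0 < h x"
  shows "aff_dim (G \<inter> hyp) < aff_dim G"
proof -
  have sub: "G \<inter> hyp \<subseteq> G \<inter> pos" by (auto simp: hyp_def pos_def)
  have "(G \<inter> hyp) face_of (G \<inter> pos)"
    by (rule face_of_subset[OF face_hyp[OF assms(1)] sub])
      (use face_of_imp_subset[OF assms(1)] in \<open>auto simp: Q_def\<close>)
  moreover have "x \<in> G \<inter> pos" "x \<notin> G \<inter> hyp" using assms by (auto simp: hyp_def pos_def)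
  then have "G \<inter> hyp \<noteq> G \<inter> pos" by blast
  moreover have "convex (G \<inter> pos)" using face_of_imp_convex[OF assms(1)] convex_pos by (rule convex_Int)
  ultimately have "aff_dim (G \<inter> hyp) < aff_dim (G \<inter> pos)" by (intro face_of_aff_dim_lt) auto
  also have "\<dots> \<le> aff_dim G" by (simp add: aff_dim_subset)
  finally show ?thesis .
qed

lemma vertex_pos: "v \<in> vertices P \<Longrightarrow> 0 \<le> h v \<Longrightarrow> v \<in> vertices Q"
  using face_pos[of "{v}"] by (simp add: vertices_iff_face pos_def)

lemma closed_segment_pos:
  assumes "0 \<le> h u" "0 \<le> h v"
  shows "closed_segment u v \<subseteq> pos"
  using assms convex_pos by (intro closed_segment_subset) (auto simp: pos_def)

lemma edge_pos:
  assumes "closed_segment u v edge_of P" "0 \<le> h u" "0 \<le> h v"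
  shows "closed_segment u v edge_of Q"
  using assms(1) face_pos[of "closed_segment u v"] closed_segment_pos[OF assms(2,3)]
  by (simp add: edge_of_def Int_absorb2)

lemma segment_Int_pos:
  assumes "h u < 0" "0 < h v"
  shows "closed_segment u v \<inter> pos = closed_segment (cr u v) v"
    and "closed_segment u v \<inter> hyp = {cr u v}"
proof -
  obtain t where t: "0 < t" "t < 1" "cr u v = (1 - t) *\<^sub>R u + t *\<^sub>R v" "t = h u / (h u - h v)"
    using crossing_param[of h u v] assms by blast
  have hs: "h ((1 - s) *\<^sub>R u + s *\<^sub>R v) = (s - t) * (h v - h u)" for s
  proof -
    have "t * (h v - h u) = - h u" using assms t(4) by (simp add: field_simps)
    then show ?thesis unfolding h_convex_comb by (simp add: algebra_simps)
  qed
  have d: "0 < h v - h u" using assms by simp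
  have uncr: "(1 - s) *\<^sub>R u + s *\<^sub>R v = (1 - (s - t) / (1 - t)) *\<^sub>R cr u v + ((s - t) / (1 - t)) *\<^sub>R v" for s
  proof -
    define k where "k = (s - t) / (1 - t)"
    have k: "k * (1 - t) = s - t" using t(1,2) by (simp add: k_def)
    have "(1 - k) *\<^sub>R cr u v + k *\<^sub>R v = ((1 - k) * (1 - t)) *\<^sub>R u + ((1 - k) * t + k) *\<^sub>R v"
      by (simp add: t(3) algebra_simps)
    also have "(1 - k) * (1 - t) = 1 - s" using k by (simp add: left_diff_distrib)
    also have "(1 - k) * t + k = s" using k by (simp add: algebra_simps)
    finally show ?thesis by (simp add: k_def)
  qed
  show "closed_segment u v \<inter> pos = closed_segment (cr u v) v"
  proof (intro equalityI subsetI)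
    fix x assume x: "x \<in> closed_segment u v \<inter> pos"
    then obtain s where s: "0 \<le> s" "s \<le> 1" "x = (1 - s) *\<^sub>R u + s *\<^sub>R v" by (auto simp: in_segment)
    then have "0 \<le> (s - t) * (h v - h u)" using x hs by (simp add: pos_def)
    then have "t \<le> s" using d by (simp add: zero_le_mult_iff)
    then have "0 \<le> (s - t) / (1 - t)" "(s - t) / (1 - t) \<le> 1" using t s by auto
    then show "x \<in> closed_segment (cr u v) v" using uncr s(3) by (metis in_segment(1))
  next
    fix x assume x: "x \<in> closed_segment (cr u v) v"
    have "cr u v \<in> closed_segment u v"
      by (rule cr_in_segment(2)[OF assms])
    then have "closed_segment (cr u v) v \<subseteq> closed_segment u v" by (simp add: subset_closed_segment)
    moreover have "closed_segment (cr u v) v \<subseteq> pos"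
      using assms by (intro closed_segment_pos) auto
    ultimately show "x \<in> closed_segment u v \<inter> pos" using x by blast
  qed
  show "closed_segment u v \<inter> hyp = {cr u v}"
  proof (intro equalityI subsetI)
    fix x assume x: "x \<in> closed_segment u v \<inter> hyp"
    then obtain s where s: "0 \<le> s" "s \<le> 1" "x = (1 - s) *\<^sub>R u + s *\<^sub>R v" by (auto simp: in_segment)
    then have "s = t" using x hs d by (auto simp: hyp_def)
    then show "x \<in> {cr u v}" using s t by simp
  next
    fix x assume "x \<in> {cr u v}"
    then show "x \<in> closed_segment u v \<inter> hyp"
      using cr_in_segment(2)[OF assms] assms by (auto simp: hyp_def)
  qed
qed

lemma vertex_crossing:
  assumes "closed_segment u v edge_of P" "h u < 0" "0 < h v"
  shows "cr u v \<in> vertices Q"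
  using face_hyp[of "closed_segment u v"] assms by (simp add: segment_Int_pos vertices_iff_face edge_of_def)

lemma edge_crossing:
  assumes "closed_segment u v edge_of P" "h u < 0" "0 < h v"
  shows "closed_segment (cr u v) v edge_of Q"
proof -
  have "cr u v \<noteq> v" using assms h_crossing by (metis less_irrefl)
  then have "aff_dim (closed_segment (cr u v) v) = 1" by (rule aff_dim_closed_segment)
  then show ?thesis
    using face_pos[of "closed_segment u v"] assms by (simp add: segment_Int_pos edge_of_def)
qed

text \<open>The new hyperplane meets a 2-face in a face of \<open>Q\<close> of dimension at most 1. If it crosses two edges
  of the 2-face, the two crossing points are vertices of that segment, hence its ends. The
  edges inside the new facet along which the path runs arise in this way.\<close>

lemma edge_in_hyp:
  assumes G: "G face_of P" "aff_dim G \<le> 2" and in_G: "u \<in> G" "v \<in> G" "u' \<in> G" "v' \<in> G"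
    and e: "closed_segment u v edge_of P" "h u < 0" "0 < h v"
    and e': "closed_segment u' v' edge_of P" "h u' < 0" "0 < h v'"
    and ne: "cr u v \<noteq> cr u' v'"
  shows "closed_segment (cr u v) (cr u' v') edge_of Q"
proof -
  let ?S = "G \<inter> hyp"
  have S: "?S face_of Q" by (rule face_hyp[OF G(1)])
  have dim: "aff_dim ?S \<le> 1" using aff_dim_hyp[OF G(1) in_G(2) e(3)] G(2) by linarith
  have cG: "convex G" by (rule face_of_imp_convex[OF G(1)])
  have "cr u v \<in> G" "cr u' v' \<in> G"
    using cr_in_segment(2)[OF e(2,3)] cr_in_segment(2)[OF e'(2,3)] in_G
      closed_segment_subset[OF _ _ cG] by blast+
  then have in_S: "cr u v \<in> ?S" "cr u' v' \<in> ?S" using e e' by (auto simp: hyp_def)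
  have "polytope ?S" by (rule face_of_polytope_polytope[OF polytope_Q S])
  moreover have "collinear ?S" using dim by (simp add: collinear_aff_dim)
  ultimately obtain c d where cd: "?S = closed_segment c d"
    using compact_convex_collinear_segment[of ?S] in_S polytope_imp_compact polytope_imp_convex by blast
  have "cr u v extreme_point_of ?S" "cr u' v' extreme_point_of ?S"
    using extreme_point_of_face[OF S] in_S vertex_crossing[OF e] vertex_crossing[OF e']
    by (auto simp: vertices_def)
  then have "cr u v = c \<or> cr u v = d" "cr u' v' = c \<or> cr u' v' = d"
    unfolding cd extreme_point_of_segment by auto
  then have eq: "?S = closed_segment (cr u v) (cr u' v')"
    using ne cd closed_segment_commute by metis
  then have "aff_dim ?S = 1" using aff_dim_closed_segment[OF ne] by simp
  then show ?thesis using S eq by (simp add: edge_of_def)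
qed

end

text \<open>Facets through an interior point of an edge contain the whole edge, and not all facets at the
  endpoint \<open>v\<close> do. So an edge at a vertex with four facets lies in at most three facets, and cutting
  it creates a vertex with at most four.\<close>

lemma facets_through_edge_point:
  fixes P :: "'a::euclidean_space set"
  assumes P: "polytope P" "1 < aff_dim P" and e: "closed_segment u v edge_of P" and p: "p \<in> open_segment u v"
  shows "card {F \<in> facets P. p \<in> F} < card {F \<in> facets P. v \<in> F}"
proof -
  have ends: "u \<in> P" "v \<in> P" using e edge_of_imp_subset by fastforce+
  have "u \<in> F \<and> v \<in> F" if "F facet_of P" "p \<in> F" for F
    using face_ofD[OF facet_of_imp_face_of[OF that(1)] p ends that(2)] .
  then have sub: "{F \<in> facets P. p \<in> F} \<subseteq> {F \<in> facets P. u \<in> F \<and> v \<in> F}" by (auto simp: facets_def)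
  have v: "{v} face_of P" using closed_segment_edge_imp_vertices[OF e] by (simp add: vertices_iff_face)
  have "{v} \<noteq> P" using P(2) by auto
  moreover have "\<not> {u} \<subseteq> {v}" using e by (auto simp: edge_of_def)
  ultimately obtain F where F: "F facet_of P" "{v} \<subseteq> F" "\<not> {u} \<subseteq> F"
    using facet_avoiding_set[OF P(1) v] by blast
  then have "{F \<in> facets P. p \<in> F} \<subset> {F \<in> facets P. v \<in> F}" using sub by (auto simp: facets_def)
  then show ?thesis by (intro psubset_card_mono) (simp_all add: finite_facets P)
qed

locale full_cut = cut +
  fixes x0
  assumes full: "aff_dim P = int DIM('a)" and x0: "x0 \<in> P" "0 < h x0"
begin

lemma open_pos: "open {x. 0 < h x}"
  unfolding h_def by (simp add: open_halfspace_gt)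

lemma full_Q: "aff_dim Q = int DIM('a)"
proof -
  have "rel_interior P = interior P" using full by (simp add: rel_interior_interior aff_dim_eq_full)
  then have "interior P \<noteq> {}" using x0 rel_interior_eq_empty[OF convex_P] by auto
  then have "P \<subseteq> closure (interior P)" using convex_closure_interior[OF convex_P] closure_subset by blast
  then have "x0 \<in> closure (interior P)" using x0 by blast
  then have "{x. 0 < h x} \<inter> interior P \<noteq> {}"
    using open_Int_closure_eq_empty[OF open_pos, of "interior P"] x0 by blast
  moreover have "{x. 0 < h x} \<inter> interior P \<subseteq> interior Q"
    by (rule interior_maximal) (use interior_subset open_pos in \<open>auto simp: Q_def pos_def\<close>)
  ultimately show ?thesis by (intro aff_dim_nonempty_interior) blast
qed

text \<open>A facet not contained in the new hyperplane has a relatively interior point \<open>y\<close> strictly on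
  the kept side. Near \<open>y\<close> the sets \<open>P\<close> and \<open>Q\<close> agree, so \<open>y\<close> lies on the boundary of \<open>P\<close>, that is on
  some facet of \<open>P\<close>.\<close>

lemma facet_of_cut:
  assumes F: "F facet_of Q"
  shows "F = P \<inter> hyp \<or> (\<exists>G. G facet_of P \<and> F = G \<inter> pos)"
proof -
  have FQ: "F face_of Q" "F \<noteq> {}" and dF: "aff_dim F = int DIM('a) - 1"
    using F full_Q by (auto simp: facet_of_def)
  have conF: "convex F" by (rule face_of_imp_convex[OF FQ(1)])
  have equal: "F = G" if G: "G face_of Q" "F \<subseteq> G" "aff_dim G < int DIM('a)" for G
  proof (rule ccontr)
    assume "F \<noteq> G"
    moreover have "F face_of G" by (rule face_of_subset[OF FQ(1) G(2) face_of_imp_subset[OF G(1)]])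
    ultimately have "aff_dim F < aff_dim G"
      using face_of_aff_dim_lt face_of_imp_convex[OF G(1)] by blast
    then show False using dF G(3) by linarith
  qed
  show ?thesis
  proof (cases "F \<subseteq> hyp")
    case True
    have "aff_dim (P \<inter> hyp) < aff_dim P"
      using aff_dim_hyp[OF face_of_refl[OF convex_P]] x0 by blast
    moreover have "F \<subseteq> P \<inter> hyp" using True face_of_imp_subset[OF FQ(1)] by (auto simp: Q_def)
    ultimately have "F = P \<inter> hyp"
      using equal[OF face_hyp[OF face_of_refl[OF convex_P]]] full by linarith
    then show ?thesis by blast
  next
    case False
    then obtain x where "x \<in> F" "x \<notin> hyp" by blast
    then have "x \<in> {x. 0 < h x}" using face_of_imp_subset[OF FQ(1)] by (auto simp: Q_def pos_def hyp_def)
    moreover have "x \<in> closure (rel_interior F)"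
      using \<open>x \<in> F\<close> convex_closure_rel_interior[OF conF] closure_subset by blast
    ultimately obtain y where y: "y \<in> rel_interior F" "0 < h y"
      using open_Int_closure_eq_empty[OF open_pos, of "rel_interior F"] by blast
    have "F \<noteq> Q" using dF full_Q by auto
    then have "y \<notin> rel_interior Q"
      using face_of_disjoint_rel_interior[OF FQ(1)] y rel_interior_subset by blast
    then have yQ: "y \<notin> interior Q" using interior_subset_rel_interior by blast
    have "y \<notin> interior P"
    proof
      assume "y \<in> interior P"
      then have "y \<in> interior P \<inter> {x. 0 < h x}" using y by simp
      moreover have "interior P \<inter> {x. 0 < h x} \<subseteq> interior Q"
        by (rule interior_maximal) (use interior_subset open_pos in \<open>auto simp: Q_def pos_def\<close>)
      ultimately show False using yQ by blast
    qed
    then have "y \<notin> rel_interior P" using full by (simp add: rel_interior_interior aff_dim_eq_full)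
    moreover have "y \<in> P" using y rel_interior_subset face_of_imp_subset[OF FQ(1)] by (auto simp: Q_def)
    ultimately obtain G where G: "G facet_of P" "y \<in> G"
      using rel_boundary_of_polyhedron[OF polytope_imp_polyhedron[OF polytope_P]] by blast
    have GQ: "(G \<inter> pos) face_of Q" by (rule face_pos[OF facet_of_imp_face_of[OF G(1)]])
    have "F \<subseteq> G \<inter> pos"
      by (rule subset_of_face_of[OF GQ face_of_imp_subset[OF FQ(1)]]) (use G y in \<open>auto simp: pos_def\<close>)
    moreover have "aff_dim (G \<inter> pos) < int DIM('a)"
    proof -
      have "aff_dim (G \<inter> pos) \<le> aff_dim G" by (simp add: aff_dim_subset)
      also have "\<dots> < int DIM('a)" using G(1) full by (simp add: facet_of_def)
      finally show ?thesis .
    qed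
    ultimately show ?thesis using equal[OF GQ] G(1) by blast
  qed
qed

lemma facets_cut_subset: "{F \<in> facets Q. v \<in> F} \<subseteq>
    (\<lambda>G. G \<inter> pos) ` {G \<in> facets P. v \<in> G} \<union> (if v \<in> hyp then {P \<inter> hyp} else {})"
  using facet_of_cut by (auto simp: facets_def)

lemma card_facets_at_cut_le:
  "card {F \<in> facets Q. v \<in> F} \<le> card {G \<in> facets P. v \<in> G} + (if h v = 0 then 1 else 0)"
proof -
  have fin: "finite {G \<in> facets P. v \<in> G}" by (simp add: finite_facets polytope_P)
  have "card {F \<in> facets Q. v \<in> F} \<le> card ((\<lambda>G. G \<inter> pos) ` {G \<in> facets P. v \<in> G} \<union> (if v \<in> hyp then {P \<inter> hyp} else {}))"
    using fin by (intro card_mono facets_cut_subset) auto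
  also have "\<dots> \<le> card ((\<lambda>G. G \<inter> pos) ` {G \<in> facets P. v \<in> G}) + card (if v \<in> hyp then {P \<inter> hyp} else {})"
    by (rule card_Un_le)
  also have "\<dots> \<le> card {G \<in> facets P. v \<in> G} + (if h v = 0 then 1 else 0)"
    using fin by (intro add_mono card_image_le) (auto simp: hyp_def)
  finally show ?thesis .
qed

lemma card_facets_cut_le: "card (facets Q) \<le> card (facets P) + 1"
proof -
  have fin: "finite (facets P)" by (simp add: finite_facets polytope_P)
  have "facets Q \<subseteq> insert (P \<inter> hyp) ((\<lambda>G. G \<inter> pos) ` facets P)"
    using facet_of_cut by (auto simp: facets_def)
  then have "card (facets Q) \<le> card (insert (P \<inter> hyp) ((\<lambda>G. G \<inter> pos) ` facets P))"
    using fin by (intro card_mono) auto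
  also have "\<dots> \<le> Suc (card ((\<lambda>G. G \<inter> pos) ` facets P))" by (rule card_insert_le_m1) simp_all
  also have "\<dots> \<le> card (facets P) + 1" using card_image_le[OF fin] by simp
  finally show ?thesis .
qed

end

section \<open>The invariant and the choice of the cutting hyperplane\<close>

text \<open>The relation between consecutive vertices of the path: besides being an increasing edge, it
  prescribes how the path passes the vertices of the distinguished 2-face. The path enters the last
  vertex $x_{r-1}$ from $w$. At every other $x_i$ it arrives and departs by the edges $x_i y_i$ and $x_i z_i$,
  and the comparison of $y_i$ with $x_i$ determines which of them is for arriving. At $x_{r-1}$ the
  path leaves along $x_{r-1} y_{r-1}$.\<close>

definition link :: "'a::euclidean_space set \<Rightarrow> 'a \<Rightarrow> 'a \<Rightarrow> (nat \<Rightarrow> 'a) \<Rightarrow> (nat \<Rightarrow> 'a) \<Rightarrow> (nat \<Rightarrow> 'a) \<Rightarrow> nat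
    \<Rightarrow> 'a \<Rightarrow> 'a \<Rightarrow> bool"
  where "link P q w x y z r s s' \<longleftrightarrow>
    closed_segment s s' edge_of P \<and> q \<bullet> s < q \<bullet> s' \<and> (s = w \<longleftrightarrow> s' = x (r - 1)) \<and>
    (\<forall>i<r. s = x i \<longrightarrow> s' = (if q \<bullet> y i < q \<bullet> x i then z i else y i)) \<and>
    (\<forall>i<r - 1. s' = x i \<longrightarrow> s = (if q \<bullet> y i < q \<bullet> x i then y i else z i))"

text \<open>\<open>A\<close> is a 2-face with vertices \<open>w\<close> and \<open>x 0, \<dots>, x (r - 1)\<close>, the first and last of
  which are the neighbours of \<open>w\<close> in \<open>A\<close>. At \<open>x i\<close> two edges leave \<open>A\<close>; their other ends
  are \<open>y i\<close>, which lies in the facet \<open>F\<close> that contains \<open>A\<close>, and \<open>z i\<close>, which does not. The remaining faces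
  are there because the new hyperplane meets them in new edges or new 2-faces: \<open>R i\<close> yields the
  edge between \<open>\<alpha> i\<close> and \<open>\<beta> i\<close>, \<open>W\<close> the edge between \<open>p1\<close> and \<open>\<beta> (r - 1)\<close>, and \<open>V\<close> the edge between
  \<open>\<alpha> 0\<close> and \<open>p0\<close>, while the 3-face \<open>T\<close> yields the next \<open>V\<close>.

  The functional \<open>\<lambda>p. c \<bullet> p - d\<close> vanishes on \<open>A\<close> and is positive at the other path vertices; the new hyperplane
  is a perturbation of its zero set. When that perturbation has size \<open>\<epsilon>\<close>, the vertices \<open>\<alpha> i\<close> and
  \<open>\<beta> i\<close> move away from \<open>x i\<close> in the direction of the objective \<open>q\<close> at rates proportional to
  \<open>q \<bullet> (y i - x i) / (c \<bullet> y i - d)\<close> and \<open>q \<bullet> (z i - x i) / (c \<bullet> z i - d)\<close>. The assumption \<open>slopes\<close>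
  compares these rates and thereby fixes the order of \<open>\<alpha> i\<close> and \<open>\<beta> i\<close>. It is immediate when in height \<open>x i\<close>
  lies between \<open>y i\<close> and \<open>z i\<close>, and has real content only for the simplex, whose path ends
  in \<open>x 0\<close> with both neighbours below it.\<close>

locale sewing =
  fixes P :: "'a::euclidean_space set" and q :: 'a and L :: "'a list" and r :: nat
    and w :: 'a and x y z :: "nat \<Rightarrow> 'a" and A F W V T :: "'a set" and R :: "nat \<Rightarrow> 'a set"
    and c :: 'a and d :: real
  assumes dim4: "DIM('a) = 4" and polytope: "polytope P" and full: "aff_dim P = int DIM('a)"
    and card_facets: "card (facets P) \<le> r + 3"
    and card_facets_at: "\<And>v. v \<in> set L \<Longrightarrow> card {G \<in> facets P. v \<in> G} \<le> 4"
    and r: "2 \<le> r"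
    and faces: "A face_of P" "F face_of P" "W face_of P" "V face_of P" "T face_of P"
      "\<And>i. i < r \<Longrightarrow> R i face_of P"
    and dims: "aff_dim A \<le> 2" "aff_dim F \<le> 3" "aff_dim W \<le> 2" "aff_dim V \<le> 2" "aff_dim T \<le> 3"
      "\<And>i. i < r \<Longrightarrow> aff_dim (R i) \<le> 2"
    and A_sub_F: "A \<subseteq> F"
    and in_A: "w \<in> A" "\<And>i. i < r \<Longrightarrow> x i \<in> A"
    and in_W: "w \<in> W" "x (r - 1) \<in> W" "z (r - 1) \<in> W"
    and in_V: "w \<in> V" "x 0 \<in> V" "y 0 \<in> V"
    and in_T: "w \<in> T" "x 0 \<in> T" "y 0 \<in> T" "z 0 \<in> T"
    and in_R: "\<And>i. i < r \<Longrightarrow> x i \<in> R i" "\<And>i. i < r \<Longrightarrow> y i \<in> R i" "\<And>i. i < r \<Longrightarrow> z i \<in> R i"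
    and y: "\<And>i. i < r \<Longrightarrow> y i \<in> F" "\<And>i. i < r \<Longrightarrow> y i \<notin> A"
    and z: "\<And>i. i < r \<Longrightarrow> z i \<notin> F"
    and inj: "inj_on x {..<r}" and x_neq_w: "\<And>i. i < r \<Longrightarrow> x i \<noteq> w"
    and edges: "closed_segment (x 0) w edge_of P" "closed_segment (x (r - 1)) w edge_of P"
      "\<And>i. i < r \<Longrightarrow> closed_segment (x i) (y i) edge_of P"
      "\<And>i. i < r \<Longrightarrow> closed_segment (x i) (z i) edge_of P"
    and L_vertices: "set L \<subseteq> vertices P"
    and in_L: "w \<in> set L" "\<And>i. i < r \<Longrightarrow> x i \<in> set L" "\<And>i. i < r \<Longrightarrow> y i \<in> set L"
      "\<And>i. i < r \<Longrightarrow> z i \<in> set L"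
    and A_vertices: "A \<inter> set L \<subseteq> insert w (x ` {..<r})"
    and support: "\<And>p. p \<in> A \<Longrightarrow> c \<bullet> p = d" "\<And>v. v \<in> set L \<Longrightarrow> v \<notin> A \<Longrightarrow> d < c \<bullet> v"
    and w_first: "\<And>i. i < r \<Longrightarrow> q \<bullet> w < q \<bullet> x i" "q \<bullet> z (r - 1) < q \<bullet> w" "q \<bullet> x (r - 1) < q \<bullet> y (r - 1)"
    and slopes: "\<And>i. i < r \<Longrightarrow> if q \<bullet> y i < q \<bullet> x i
      then (q \<bullet> y i - q \<bullet> x i) * (c \<bullet> z i - d) < (q \<bullet> z i - q \<bullet> x i) * (c \<bullet> y i - d)
      else q \<bullet> x i < q \<bullet> y i \<and>
        (q \<bullet> z i - q \<bullet> x i) * (c \<bullet> y i - d) < (q \<bullet> y i - q \<bullet> x i) * (c \<bullet> z i - d)"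
    and path: "successively (link P q w x y z r) L"
    and len: "2 * length L = r * (r + 3)"
begin

lemma z_notin_A: "i < r \<Longrightarrow> z i \<notin> A"
  using z A_sub_F by blast

lemma vertex_on_edge_line:
  assumes "closed_segment u v edge_of P" "s \<in> vertices P" "s \<in> affine hull {u, v}"
  shows "s = u \<or> s = v"
proof -
  have e: "closed_segment u v face_of P" using assms(1) by (simp add: edge_of_def)
  have "s \<in> P" using assms(2) by (simp add: vertices_def extreme_point_of_def)
  then have "s \<in> affine hull (closed_segment u v) \<inter> P" using assms(3) by (simp add: segment_convex_hull)
  then have "s \<in> closed_segment u v"
    using face_of_imp_eq_affine_Int[OF polytope_imp_convex[OF polytope] e] by simp
  then have "s extreme_point_of closed_segment u v"
    using extreme_point_of_face[OF e] assms(2) by (simp add: vertices_def)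
  then show ?thesis by (simp add: extreme_point_of_segment)
qed

text \<open>The objective alone, used as the perturbing functional, would put \<open>p0\<close> and \<open>p1\<close> at the same
  height. Adding a small multiple of \<open>k\<close> lowers \<open>p0\<close> and leaves \<open>p1\<close> in place. Such a \<open>k\<close>
  exists because \<open>w\<close>, \<open>x 0\<close> and \<open>x (r - 1)\<close> are not collinear: the line of the edge from
  \<open>x (r - 1)\<close> to \<open>w\<close> contains no third vertex.\<close>

lemma tilt_direction:
  obtains k where "k \<bullet> (x (r - 1) - w) = 0" "0 < k \<bullet> (x 0 - w)"
proof -
  define u1 u2 where "u1 = x 0 - w" and "u2 = x (r - 1) - w"
  define l where "l = (u1 \<bullet> u2) / (u2 \<bullet> u2)"
  define k where "k = u1 - l *\<^sub>R u2"
  have u2: "u2 \<noteq> 0" using x_neq_w[of "r - 1"] r by (simp add: u2_def)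
  have k2: "k \<bullet> u2 = 0" using u2 by (simp add: k_def l_def inner_diff_left)
  have "k \<noteq> 0"
  proof
    assume "k = 0"
    then have "x 0 = w + l *\<^sub>R (x (r - 1) - w)" by (simp add: k_def u1_def u2_def algebra_simps)
    then have "x 0 = l *\<^sub>R x (r - 1) + (1 - l) *\<^sub>R w" by (simp add: algebra_simps)
    then have "x 0 \<in> affine hull {x (r - 1), w}" unfolding affine_hull_2 by force
    moreover have "x 0 \<in> vertices P" using in_L(2)[of 0] L_vertices r by auto
    ultimately have "x 0 = x (r - 1) \<or> x 0 = w" using vertex_on_edge_line[OF edges(2)] by blast
    moreover have "x 0 \<noteq> x (r - 1)"
    proof
      assume "x 0 = x (r - 1)"
      then have "0 = r - 1" using r by (intro inj_onD[OF inj]) auto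
      then show False using r by simp
    qed
    moreover have "x 0 \<noteq> w" using x_neq_w[of 0] r by simp
    ultimately show False by blast
  qed
  have "k \<bullet> u1 = k \<bullet> k + l * (k \<bullet> u2)" by (simp add: k_def inner_diff_left inner_diff_right algebra_simps)
  then have "0 < k \<bullet> u1" using k2 \<open>k \<noteq> 0\<close> by simp
  then show ?thesis using that k2 by (simp add: u1_def u2_def)
qed

definition cutting :: "'a \<Rightarrow> real \<Rightarrow> bool"
  where "cutting a b \<longleftrightarrow>
    (\<forall>i<r. a \<bullet> x i < b) \<and> (\<forall>v\<in>set L. v \<notin> x ` {..<r} \<longrightarrow> b < a \<bullet> v) \<and>
    (let cr = crossing (\<lambda>p. a \<bullet> p - b) in
      q \<bullet> cr (x 0) w < q \<bullet> cr (x (r - 1)) w \<and>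
      (\<forall>i<r. q \<bullet> cr (x (r - 1)) w < q \<bullet> cr (x i) (y i) \<and> q \<bullet> cr (x (r - 1)) w < q \<bullet> cr (x i) (z i) \<and>
        (if q \<bullet> y i < q \<bullet> x i then q \<bullet> cr (x i) (y i) < q \<bullet> cr (x i) (z i)
         else q \<bullet> cr (x i) (z i) < q \<bullet> cr (x i) (y i))))"

lemma inner_crossing: "q \<bullet> crossing h u v = q \<bullet> u + (h u / (h u - h v)) * (q \<bullet> v - q \<bullet> u)"
  for h :: "'a \<Rightarrow> real"
  by (simp add: crossing_def inner_add_right inner_diff_right)

text \<open>The functional is $h = g - \varepsilon l$ with $g(p) = c \cdot p - d$ and
  $l(p) = q \cdot (p - w) + \eta\, k \cdot (p - w) - \delta$. On \<open>A\<close> only $l$ matters. It is negative at \<open>w\<close>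
  and, for small $\eta$ and $\delta$, positive at every \<open>x i\<close>, and the crossing points \<open>p0\<close> and \<open>p1\<close>
  are the same for all $\varepsilon$: \<open>p1\<close> is at height exactly $q \cdot w + \delta$, and \<open>p0\<close> is lower.
  All remaining requirements are finitely many strict inequalities that hold in the limit
  $\varepsilon \to 0$, when \<open>\<alpha> i\<close> and \<open>\<beta> i\<close> converge to \<open>x i\<close>.\<close>

lemma cutting_hyperplane_exists: "\<exists>a b. cutting a b"
proof -
  obtain k where k: "k \<bullet> (x (r - 1) - w) = 0" "0 < k \<bullet> (x 0 - w)" using tilt_direction .
  define l0 where "l0 \<eta> p = q \<bullet> (p - w) + \<eta> * (k \<bullet> (p - w))" for \<eta> p
  have "\<forall>\<^sub>F \<eta> in at_right 0. 0 < \<eta> \<and> (\<forall>i\<in>{..<r}. 0 < l0 \<eta> (x i))"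
  proof (intro eventually_conj)
    show "\<forall>\<^sub>F \<eta> in at_right 0. 0 < (\<eta>::real)" by (rule eventually_at_right_less)
    show "\<forall>\<^sub>F \<eta> in at_right 0. \<forall>i\<in>{..<r}. 0 < l0 \<eta> (x i)"
    proof (rule eventually_ball_finite, simp, intro ballI)
      fix i assume i: "i \<in> {..<r}"
      have "((\<lambda>\<eta>. l0 \<eta> (x i)) \<longlongrightarrow> q \<bullet> (x i - w) + 0 * (k \<bullet> (x i - w))) (at_right 0)"
        unfolding l0_def by (intro tendsto_intros)
      moreover have "0 < q \<bullet> (x i - w)" using w_first(1) i by (simp add: inner_diff_right)
      ultimately show "\<forall>\<^sub>F \<eta> in at_right 0. 0 < l0 \<eta> (x i)" by (intro order_tendstoD(1)) auto
    qed
  qed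
  from eventually_happens'[OF trivial_limit_at_right_real this] obtain \<eta> where \<eta>: "0 < \<eta>" "\<And>i. i < r \<Longrightarrow> 0 < l0 \<eta> (x i)" by auto
  let ?D = "insert 1 ((\<lambda>i. l0 \<eta> (x i)) ` {..<r} \<union> (\<lambda>i. q \<bullet> (x i - w)) ` {..<r})"
  define \<delta> where "\<delta> = Min ?D / 2"
  have M: "0 < Min ?D" using \<eta> w_first(1) by (subst Min_gr_iff) (auto simp: inner_diff_right)
  then have \<delta>0: "0 < \<delta>" "\<delta> < Min ?D" by (simp_all add: \<delta>_def)
  have \<delta>1: "\<delta> < l0 \<eta> (x i)" "\<delta> < q \<bullet> (x i - w)" if "i < r" for i
    using \<delta>0(2) that by (auto intro!: less_le_trans[OF \<delta>0(2) Min_le])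
  note \<delta> = \<delta>0(1) \<delta>1
  define l where "l p = l0 \<eta> p - \<delta>" for p
  have l_w: "l w = - \<delta>" by (simp add: l_def l0_def)
  have l_x: "0 < l (x i)" if "i < r" for i using \<delta>(2)[OF that] by (simp add: l_def)
  define g where "g p = c \<bullet> p - d" for p
  have g_pos: "0 < g v" if "v \<in> set L" "v \<notin> A" for v using support(2)[OF that] by (simp add: g_def)
  have g_x: "g (x i) = 0" if "i < r" for i using support(1) in_A(2)[OF that] by (simp add: g_def)
  have g_w: "g w = 0" using support(1) in_A(1) by (simp add: g_def)
  define h where "h \<epsilon> p = g p - \<epsilon> * l p" for \<epsilon> p
  define rate where "rate i v \<epsilon> = (q \<bullet> v - q \<bullet> x i) / (g v + \<epsilon> * (l (x i) - l v))" for i v \<epsilon>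
  have cross: "q \<bullet> crossing (h \<epsilon>) (x i) v = q \<bullet> x i + \<epsilon> * l (x i) * rate i v \<epsilon>"
    if "i < r" for i v \<epsilon>
  proof -
    have "h \<epsilon> (x i) - h \<epsilon> v = - (g v + \<epsilon> * (l (x i) - l v))"
      using g_x[OF that] by (simp add: h_def algebra_simps)
    moreover have "h \<epsilon> (x i) = - (\<epsilon> * l (x i))" using g_x[OF that] by (simp add: h_def)
    ultimately show ?thesis unfolding inner_crossing
      by (simp only: minus_divide_divide rate_def times_divide_eq_left times_divide_eq_right)
  qed
  have rate_lim: "(rate i v \<longlongrightarrow> (q \<bullet> v - q \<bullet> x i) / g v) (at_right 0)" if "0 < g v" for i v
  proof -
    have "(rate i v \<longlongrightarrow> (q \<bullet> v - q \<bullet> x i) / (g v + 0 * (l (x i) - l v))) (at_right 0)"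
      unfolding rate_def using that by (intro tendsto_intros) auto
    then show ?thesis by simp
  qed
  have gy: "0 < g (y i)" and gz: "0 < g (z i)" if "i < r" for i
    using that g_pos in_L y z_notin_A by auto
  have ev_close: "\<forall>\<^sub>F \<epsilon> in at_right 0. q \<bullet> w + \<delta> < q \<bullet> x i + \<epsilon> * l (x i) * rate i v \<epsilon>"
    if "i < r" "0 < g v" for i v
  proof -
    have "((\<lambda>\<epsilon>. q \<bullet> x i + \<epsilon> * l (x i) * rate i v \<epsilon>) \<longlongrightarrow>
        q \<bullet> x i + 0 * l (x i) * ((q \<bullet> v - q \<bullet> x i) / g v)) (at_right 0)"
      by (intro tendsto_intros rate_lim that)
    moreover have "q \<bullet> w + \<delta> < q \<bullet> x i" using \<delta>(3)[OF that(1)] by (simp add: inner_diff_right)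
    ultimately show ?thesis by (intro order_tendstoD(1)) auto
  qed
  have ev_less: "\<forall>\<^sub>F \<epsilon> in at_right 0. rate i v \<epsilon> < rate i v' \<epsilon>"
    if "0 < g v" "0 < g v'" "(q \<bullet> v - q \<bullet> x i) * g v' < (q \<bullet> v' - q \<bullet> x i) * g v" for i v v'
  proof -
    have "(q \<bullet> v - q \<bullet> x i) / g v < (q \<bullet> v' - q \<bullet> x i) / g v'"
      using that by (simp add: divide_simps mult.commute)
    then obtain m where "(q \<bullet> v - q \<bullet> x i) / g v < m" "m < (q \<bullet> v' - q \<bullet> x i) / g v'" using dense by blast
    then have "\<forall>\<^sub>F \<epsilon> in at_right 0. rate i v \<epsilon> < m" "\<forall>\<^sub>F \<epsilon> in at_right 0. m < rate i v' \<epsilon>"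
      by (auto intro: order_tendstoD(2)[OF rate_lim[OF that(1)]] order_tendstoD(1)[OF rate_lim[OF that(2)]])
    then show ?thesis by eventually_elim linarith
  qed
  have "\<forall>\<^sub>F \<epsilon> in at_right 0. 0 < \<epsilon> \<and> (\<forall>v\<in>set L - A. 0 < h \<epsilon> v) \<and>
     (\<forall>i\<in>{..<r}. q \<bullet> w + \<delta> < q \<bullet> x i + \<epsilon> * l (x i) * rate i (y i) \<epsilon> \<and>
        q \<bullet> w + \<delta> < q \<bullet> x i + \<epsilon> * l (x i) * rate i (z i) \<epsilon> \<and>
        (if q \<bullet> y i < q \<bullet> x i then rate i (y i) \<epsilon> < rate i (z i) \<epsilon>
         else rate i (z i) \<epsilon> < rate i (y i) \<epsilon>))"
  proof (intro eventually_conj)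
    show "\<forall>\<^sub>F \<epsilon> in at_right 0. 0 < (\<epsilon>::real)" by (rule eventually_at_right_less)
    show "\<forall>\<^sub>F \<epsilon> in at_right 0. \<forall>v\<in>set L - A. 0 < h \<epsilon> v"
    proof (rule eventually_ball_finite, simp, intro ballI)
      fix v assume v: "v \<in> set L - A"
      have "((\<lambda>\<epsilon>. h \<epsilon> v) \<longlongrightarrow> g v - 0 * l v) (at_right 0)" unfolding h_def by (intro tendsto_intros)
      then show "\<forall>\<^sub>F \<epsilon> in at_right 0. 0 < h \<epsilon> v" using g_pos v by (intro order_tendstoD(1)) auto
    qed
    show "\<forall>\<^sub>F \<epsilon> in at_right 0. \<forall>i\<in>{..<r}. q \<bullet> w + \<delta> < q \<bullet> x i + \<epsilon> * l (x i) * rate i (y i) \<epsilon> \<and>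
        q \<bullet> w + \<delta> < q \<bullet> x i + \<epsilon> * l (x i) * rate i (z i) \<epsilon> \<and>
        (if q \<bullet> y i < q \<bullet> x i then rate i (y i) \<epsilon> < rate i (z i) \<epsilon>
         else rate i (z i) \<epsilon> < rate i (y i) \<epsilon>)"
    proof (rule eventually_ball_finite, simp, intro ballI eventually_conj)
      fix i assume "i \<in> {..<r}"
      then have i: "i < r" by simp
      show "\<forall>\<^sub>F \<epsilon> in at_right 0. q \<bullet> w + \<delta> < q \<bullet> x i + \<epsilon> * l (x i) * rate i (y i) \<epsilon>"
        by (rule ev_close[OF i gy[OF i]])
      show "\<forall>\<^sub>F \<epsilon> in at_right 0. q \<bullet> w + \<delta> < q \<bullet> x i + \<epsilon> * l (x i) * rate i (z i) \<epsilon>"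
        by (rule ev_close[OF i gz[OF i]])
      show "\<forall>\<^sub>F \<epsilon> in at_right 0. if q \<bullet> y i < q \<bullet> x i then rate i (y i) \<epsilon> < rate i (z i) \<epsilon>
         else rate i (z i) \<epsilon> < rate i (y i) \<epsilon>"
        using slopes[OF i] ev_less[OF gy[OF i] gz[OF i]] ev_less[OF gz[OF i] gy[OF i]]
        by (simp add: g_def split: if_splits)
    qed
  qed
  from eventually_happens'[OF trivial_limit_at_right_real this] obtain \<epsilon> where "0 < \<epsilon> \<and> (\<forall>v\<in>set L - A. 0 < h \<epsilon> v) \<and>
     (\<forall>i\<in>{..<r}. q \<bullet> w + \<delta> < q \<bullet> x i + \<epsilon> * l (x i) * rate i (y i) \<epsilon> \<and>
        q \<bullet> w + \<delta> < q \<bullet> x i + \<epsilon> * l (x i) * rate i (z i) \<epsilon> \<and>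
        (if q \<bullet> y i < q \<bullet> x i then rate i (y i) \<epsilon> < rate i (z i) \<epsilon>
         else rate i (z i) \<epsilon> < rate i (y i) \<epsilon>))"
    by blast
  then have \<epsilon>: "0 < \<epsilon>" "\<And>v. v \<in> set L \<Longrightarrow> v \<notin> A \<Longrightarrow> 0 < h \<epsilon> v"
    "\<And>i. i < r \<Longrightarrow> q \<bullet> w + \<delta> < q \<bullet> x i + \<epsilon> * l (x i) * rate i (y i) \<epsilon>"
    "\<And>i. i < r \<Longrightarrow> q \<bullet> w + \<delta> < q \<bullet> x i + \<epsilon> * l (x i) * rate i (z i) \<epsilon>"
    "\<And>i. i < r \<Longrightarrow> if q \<bullet> y i < q \<bullet> x i then rate i (y i) \<epsilon> < rate i (z i) \<epsilon>
         else rate i (z i) \<epsilon> < rate i (y i) \<epsilon>"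
    by (blast, blast, blast, blast, meson lessThan_iff)
  have on_wx: "q \<bullet> crossing (h \<epsilon>) (x i) w = q \<bullet> w + \<delta> * (q \<bullet> (x i - w)) / l0 \<eta> (x i)" if i: "i < r" for i
  proof -
    have l0: "l0 \<eta> (x i) \<noteq> 0" using \<eta>(2)[OF i] by simp
    have "q \<bullet> crossing (h \<epsilon>) (x i) w = q \<bullet> x i + (h \<epsilon> (x i) / (h \<epsilon> (x i) - h \<epsilon> w)) * (q \<bullet> w - q \<bullet> x i)"
      by (rule inner_crossing)
    also have "h \<epsilon> (x i) / (h \<epsilon> (x i) - h \<epsilon> w) = (\<epsilon> * (l0 \<eta> (x i) - \<delta>)) / (\<epsilon> * l0 \<eta> (x i))"
    proof -
      have "h \<epsilon> (x i) = - (\<epsilon> * (l0 \<eta> (x i) - \<delta>))" using g_x[OF i] by (simp add: h_def l_def)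
      moreover have "h \<epsilon> (x i) - h \<epsilon> w = - (\<epsilon> * l0 \<eta> (x i))"
        using g_x[OF i] g_w l_w by (simp add: h_def l_def algebra_simps)
      ultimately show ?thesis by (simp only: minus_divide_divide)
    qed
    also have "\<dots> = 1 - \<delta> / l0 \<eta> (x i)" using \<epsilon>(1) l0 by (simp add: diff_divide_distrib)
    finally show ?thesis by (simp add: inner_diff_right algebra_simps diff_divide_distrib)
  qed
  have on_last: "q \<bullet> crossing (h \<epsilon>) (x (r - 1)) w = q \<bullet> w + \<delta>"
  proof -
    have "l0 \<eta> (x (r - 1)) = q \<bullet> (x (r - 1) - w)" using k(1) by (simp add: l0_def)
    then show ?thesis using on_wx[of "r - 1"] \<eta>(2)[of "r - 1"] r by simp
  qed
  have on_first: "q \<bullet> crossing (h \<epsilon>) (x 0) w < q \<bullet> w + \<delta>"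
  proof -
    have "q \<bullet> (x 0 - w) < l0 \<eta> (x 0)" using k(2) \<eta>(1) by (simp add: l0_def)
    then have "q \<bullet> (x 0 - w) / l0 \<eta> (x 0) < 1" using \<eta>(2)[of 0] r by simp
    then have "\<delta> * (q \<bullet> (x 0 - w) / l0 \<eta> (x 0)) < \<delta> * 1" using \<delta>(1) by (intro mult_strict_left_mono)
    then show ?thesis using on_wx[of 0] r by simp
  qed
  define a where "a = c - \<epsilon> *\<^sub>R (q + \<eta> *\<^sub>R k)"
  define b where "b = d - \<epsilon> * (q \<bullet> w + \<eta> * (k \<bullet> w) + \<delta>)"
  have h: "(\<lambda>p. a \<bullet> p - b) = h \<epsilon>"
    by (rule ext) (simp add: a_def b_def h_def g_def l_def l0_def inner_diff_left inner_diff_right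
        inner_add_left algebra_simps)
  have "h \<epsilon> (x i) < 0" if "i < r" for i using g_x l_x \<epsilon>(1) that by (simp add: h_def)
  moreover have "0 < h \<epsilon> v" if "v \<in> set L" "v \<notin> x ` {..<r}" for v
  proof (cases "v \<in> A")
    case True
    then have "v = w" using A_vertices that by blast
    then show ?thesis using g_w l_w \<epsilon>(1) \<delta>(1) by (simp add: h_def)
  qed (use \<epsilon>(2) that in blast)
  moreover have "if q \<bullet> y i < q \<bullet> x i
    then q \<bullet> crossing (h \<epsilon>) (x i) (y i) < q \<bullet> crossing (h \<epsilon>) (x i) (z i)
    else q \<bullet> crossing (h \<epsilon>) (x i) (z i) < q \<bullet> crossing (h \<epsilon>) (x i) (y i)" if "i < r" for i
    using \<epsilon>(5)[OF that] \<epsilon>(1) l_x[OF that] by (simp add: cross[OF that] split: if_splits)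
  moreover have "q \<bullet> w + \<delta> < q \<bullet> crossing (h \<epsilon>) (x i) (y i)"
    "q \<bullet> w + \<delta> < q \<bullet> crossing (h \<epsilon>) (x i) (z i)" if "i < r" for i
    using \<epsilon>(3,4)[OF that] by (simp_all only: cross[OF that])
  ultimately have "cutting a b"
    unfolding cutting_def Let_def h on_last using on_first
    by (simp add: h[THEN fun_cong, symmetric])
  then show ?thesis by blast
qed

end

section \<open>The sewing step\<close>

lemma successively_concat_map:
  assumes "successively S L" "\<And>s. s \<in> set L \<Longrightarrow> E s \<noteq> [] \<and> successively S' (E s)"
    and "\<And>s s'. \<lbrakk>s \<in> set L; s' \<in> set L; S s s'\<rbrakk> \<Longrightarrow> S' (last (E s)) (hd (E s'))"
  shows "successively S' (concat (map E L))"
  using assms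
proof (induction L)
  case (Cons s L)
  show ?case
  proof (cases L)
    case Nil
    then show ?thesis using Cons.prems(2)[of s] by simp
  next
    case L: (Cons s' L')
    have "successively S' (concat (map E L))"
      by (rule Cons.IH) (use Cons.prems L in \<open>auto simp: successively_Cons\<close>)
    moreover have "S' (last (E s)) (hd (concat (map E L)))"
    proof -
      have "S s s'" using Cons.prems(1) L by simp
      then have "S' (last (E s)) (hd (E s'))" using Cons.prems(3) L by simp
      moreover have "E s' \<noteq> []" using Cons.prems(2)[of s'] L by simp
      ultimately show ?thesis using L by simp
    qed
    moreover have "E s \<noteq> []" "successively S' (E s)" using Cons.prems(2)[of s] by auto
    ultimately show ?thesis by (simp add: successively_append_iff)
  qed
qed simp

lemma length_concat_map_distinct:
  assumes "distinct L"
  shows "length (concat (map E L)) = (\<Sum>s\<in>set L. length (E s))"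
  using assms by (induction L) auto

locale sewing_step = sewing +
  fixes a b
  assumes cutting: "cutting a b"

sublocale sewing_step \<subseteq> C: full_cut P a b w
proof
  show cP: "polytope P" by (rule polytope)
  interpret cut P a b by standard (rule cP)
  show "aff_dim P = int DIM('a)" by (rule full)
  show "w \<in> P" using in_A(1) faces(1) face_of_imp_subset by blast
  have "w \<notin> x ` {..<r}" using x_neq_w by (metis imageE lessThan_iff)
  then have "b < a \<bullet> w" using cutting in_L(1) by (simp add: cutting_def)
  then show "0 < cut.h a b w" by (simp add: h_def)
qed

context sewing_step
begin

lemma h_eq: "C.h = (\<lambda>p. a \<bullet> p - b)"
  by (rule ext) (simp add: C.h_def)

lemma h_x: "i < r \<Longrightarrow> C.h (x i) < 0"
  using cutting by (simp add: cutting_def C.h_def)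

lemma h_other: "v \<in> set L \<Longrightarrow> v \<notin> x ` {..<r} \<Longrightarrow> 0 < C.h v"
  using cutting by (simp add: cutting_def C.h_def)

lemma h_w: "0 < C.h w" by (rule C.x0(2))

lemma y_other: "i < r \<Longrightarrow> y i \<notin> x ` {..<r}" "i < r \<Longrightarrow> y i \<noteq> w"
  using y(2) in_A by (metis imageE lessThan_iff)+

lemma z_other: "i < r \<Longrightarrow> z i \<notin> x ` {..<r}" "i < r \<Longrightarrow> z i \<noteq> w"
  using z_notin_A in_A by (metis imageE lessThan_iff)+

lemma w_notin_x: "w \<notin> x ` {..<r}"
  using x_neq_w by (metis imageE lessThan_iff)

lemma h_y: "i < r \<Longrightarrow> 0 < C.h (y i)" and h_z: "i < r \<Longrightarrow> 0 < C.h (z i)"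
  using h_other in_L y_other(1) z_other(1) by auto

definition p0 :: 'a where "p0 = C.cr (x 0) w"
definition p1 :: 'a where "p1 = C.cr (x (r - 1)) w"
definition \<alpha> :: "nat \<Rightarrow> 'a" where "\<alpha> i = C.cr (x i) (y i)"
definition \<beta> :: "nat \<Rightarrow> 'a" where "\<beta> i = C.cr (x i) (z i)"

lemma r0: "0 < r" and r1: "r - 1 < r" using r by auto

lemma h_new [simp]: "C.h p0 = 0" "C.h p1 = 0" "i < r \<Longrightarrow> C.h (\<alpha> i) = 0" "i < r \<Longrightarrow> C.h (\<beta> i) = 0"
  using h_x r0 r1 h_w h_y h_z by (auto simp: p0_def p1_def \<alpha>_def \<beta>_def)

lemma q_new: "q \<bullet> p0 < q \<bullet> p1" "i < r \<Longrightarrow> q \<bullet> p1 < q \<bullet> \<alpha> i" "i < r \<Longrightarrow> q \<bullet> p1 < q \<bullet> \<beta> i"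
  "i < r \<Longrightarrow> if q \<bullet> y i < q \<bullet> x i then q \<bullet> \<alpha> i < q \<bullet> \<beta> i else q \<bullet> \<beta> i < q \<bullet> \<alpha> i"
  using cutting unfolding cutting_def Let_def p0_def p1_def \<alpha>_def \<beta>_def h_eq by auto

lemma q_between:
  "q \<bullet> w < q \<bullet> p0"
  "i < r \<Longrightarrow> q \<bullet> y i < q \<bullet> x i \<Longrightarrow> q \<bullet> y i < q \<bullet> \<alpha> i"
  "i < r \<Longrightarrow> \<not> q \<bullet> y i < q \<bullet> x i \<Longrightarrow> q \<bullet> \<alpha> i < q \<bullet> y i"
  "i < r \<Longrightarrow> q \<bullet> z i < q \<bullet> x i \<Longrightarrow> q \<bullet> z i < q \<bullet> \<beta> i"
  "i < r \<Longrightarrow> q \<bullet> x i < q \<bullet> z i \<Longrightarrow> q \<bullet> \<beta> i < q \<bullet> z i"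
proof -
  show "q \<bullet> w < q \<bullet> p0" unfolding p0_def
    using crossing_between(2)[of C.h "x 0" w q] h_x[OF r0] h_w w_first(1)[OF r0] by simp
  show "q \<bullet> y i < q \<bullet> \<alpha> i" if "i < r" "q \<bullet> y i < q \<bullet> x i" unfolding \<alpha>_def
    using crossing_between(2)[of C.h "x i" "y i" q] h_x h_y that by simp
  show "q \<bullet> \<alpha> i < q \<bullet> y i" if "i < r" "\<not> q \<bullet> y i < q \<bullet> x i"
  proof -
    have "q \<bullet> x i < q \<bullet> y i" using slopes[OF that(1)] that(2) by simp
    then show ?thesis unfolding \<alpha>_def
      using crossing_between(1)[of C.h "x i" "y i" q] h_x h_y that by simp
  qed
  show "q \<bullet> z i < q \<bullet> \<beta> i" if "i < r" "q \<bullet> z i < q \<bullet> x i" unfolding \<beta>_def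
    using crossing_between(2)[of C.h "x i" "z i" q] h_x h_z that by simp
  show "q \<bullet> \<beta> i < q \<bullet> z i" if "i < r" "q \<bullet> x i < q \<bullet> z i" unfolding \<beta>_def
    using crossing_between(1)[of C.h "x i" "z i" q] h_x h_z that by simp
qed

lemma cr_in_convex:
  assumes "G face_of P" "u \<in> G" "v \<in> G" "C.h u < 0" "0 < C.h v"
  shows "C.cr u v \<in> G"
  using C.cr_in_segment(2)[OF assms(4,5)] closed_segment_subset[OF assms(2,3)]
    face_of_imp_convex[OF assms(1)] by blast

lemma cr_in_face_imp:
  assumes "G face_of P" "C.cr u v \<in> G" "closed_segment u v edge_of P" "C.h u < 0" "0 < C.h v"
  shows "u \<in> G" "v \<in> G"
proof -
  have "u \<in> P" "v \<in> P" using assms(3) edge_of_imp_subset by fastforce+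
  then show "u \<in> G" "v \<in> G"
    using face_ofD[OF assms(1) C.cr_in_segment(1)[OF assms(4,5)] _ _ assms(2)] by auto
qed

lemma new_in:
  "p0 \<in> A" "p1 \<in> A" "i < r \<Longrightarrow> \<alpha> i \<in> F" "i < r \<Longrightarrow> \<alpha> i \<notin> A" "i < r \<Longrightarrow> \<beta> i \<notin> F"
proof -
  show "p0 \<in> A" "p1 \<in> A" unfolding p0_def p1_def
    using cr_in_convex[OF faces(1)] in_A r0 r1 h_x h_w by auto
  show "\<alpha> i \<in> F" if "i < r" unfolding \<alpha>_def
    using cr_in_convex[OF faces(2)] in_A(2) A_sub_F y(1) h_x h_y that by blast
  show "\<alpha> i \<notin> A" if "i < r" unfolding \<alpha>_def
    using cr_in_face_imp(2)[OF faces(1) _ edges(3)[OF that] h_x[OF that] h_y[OF that]] y(2)[OF that] by blast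
  show "\<beta> i \<notin> F" if "i < r" unfolding \<beta>_def
    using cr_in_face_imp(2)[OF faces(2) _ edges(4)[OF that] h_x[OF that] h_z[OF that]] z[OF that] by blast
qed

text \<open>Two different edges of a polytope have no common relatively interior point.\<close>

lemma \<alpha>_inj: "i < r \<Longrightarrow> j < r \<Longrightarrow> \<alpha> i = \<alpha> j \<longleftrightarrow> i = j"
proof
  assume ij: "i < r" "j < r" and eq: "\<alpha> i = \<alpha> j"
  have face: "closed_segment (x i) (y i) face_of P" using edges(3)[OF ij(1)] by (simp add: edge_of_def)
  have "C.cr (x j) (y j) \<in> closed_segment (x i) (y i)"
    using C.cr_in_segment(2)[OF h_x[OF ij(1)] h_y[OF ij(1)]] eq by (simp add: \<alpha>_def)
  then have "x j \<in> closed_segment (x i) (y i)"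
    using cr_in_face_imp(1)[OF face _ edges(3)[OF ij(2)] h_x[OF ij(2)] h_y[OF ij(2)]] by blast
  then have "x j \<in> affine hull {x i, y i}"
    using convex_hull_subset_affine_hull by (auto simp: segment_convex_hull)
  moreover have "x j \<in> vertices P" using in_L(2)[OF ij(2)] L_vertices by blast
  ultimately have "x j = x i \<or> x j = y i" using vertex_on_edge_line[OF edges(3)[OF ij(1)]] by blast
  then have "x j = x i" using in_A(2)[OF ij(2)] y(2)[OF ij(1)] by auto
  then show "i = j" using inj_onD[OF inj, of j i] ij by simp
qed simp

lemma new_neq:
  "p0 \<noteq> p1" "p1 \<noteq> p0" "w \<noteq> p0" "w \<noteq> p1" "p0 \<noteq> w" "p1 \<noteq> w"
  "i < r \<Longrightarrow> \<alpha> i \<noteq> p0" "i < r \<Longrightarrow> p0 \<noteq> \<alpha> i" "i < r \<Longrightarrow> \<alpha> i \<noteq> p1" "i < r \<Longrightarrow> p1 \<noteq> \<alpha> i"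
  "i < r \<Longrightarrow> \<beta> i \<noteq> p0" "i < r \<Longrightarrow> p0 \<noteq> \<beta> i" "i < r \<Longrightarrow> \<beta> i \<noteq> p1" "i < r \<Longrightarrow> p1 \<noteq> \<beta> i"
  "i < r \<Longrightarrow> j < r \<Longrightarrow> \<alpha> i \<noteq> \<beta> j" "i < r \<Longrightarrow> j < r \<Longrightarrow> \<beta> j \<noteq> \<alpha> i"
proof -
  show "p0 \<noteq> p1" "p1 \<noteq> p0" "w \<noteq> p0" "w \<noteq> p1" "p0 \<noteq> w" "p1 \<noteq> w"
    using q_new(1) q_between(1) by auto
  show "\<alpha> i \<noteq> p0" "p0 \<noteq> \<alpha> i" "\<alpha> i \<noteq> p1" "p1 \<noteq> \<alpha> i" if "i < r"
    using new_in(1,2) new_in(4)[OF that] by auto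
  show "\<beta> i \<noteq> p0" "p0 \<noteq> \<beta> i" "\<beta> i \<noteq> p1" "p1 \<noteq> \<beta> i" if "i < r"
    using new_in(1,2) new_in(5)[OF that] A_sub_F by auto
  show "\<alpha> i \<noteq> \<beta> j" "\<beta> j \<noteq> \<alpha> i" if "i < r" "j < r"
    using new_in(3)[OF that(1)] new_in(5)[OF that(2)] by auto
qed

lemma old_neq:
  assumes "0 < C.h s"
  shows "s \<noteq> p0" "p0 \<noteq> s" "s \<noteq> p1" "p1 \<noteq> s" "i < r \<Longrightarrow> s \<noteq> \<alpha> i" "i < r \<Longrightarrow> \<alpha> i \<noteq> s"
    "i < r \<Longrightarrow> s \<noteq> \<beta> i" "i < r \<Longrightarrow> \<beta> i \<noteq> s"
  using assms h_new by (metis less_irrefl)+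

text \<open>The data of the next stage. The last vertex \<open>x' r\<close> is \<open>p1\<close>, whose two edges leaving the new
  2-face lead to \<open>\<beta> (r - 1)\<close> and back to \<open>w\<close>. At \<open>x' i = \<alpha> i\<close> the new facet contains the edge
  to \<open>\<beta> i\<close>, while the other edge is what remains of the edge from \<open>x i\<close> to \<open>y i\<close>; so \<open>\<beta> i\<close> takes the
  role of \<open>y i\<close>, and \<open>y i\<close> that of \<open>z i\<close>.\<close>

definition x' :: "nat \<Rightarrow> 'a" where "x' i = (if i < r then \<alpha> i else p1)"
definition y' :: "nat \<Rightarrow> 'a" where "y' i = (if i < r then \<beta> i else \<beta> (r - 1))"
definition z' :: "nat \<Rightarrow> 'a" where "z' i = (if i < r then y i else w)"
definition R' :: "nat \<Rightarrow> 'a set" where "R' i = (if i < r then R i \<inter> C.pos else W \<inter> C.pos)"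

definition expand :: "'a \<Rightarrow> 'a list" where
  "expand s = (if s = w then [w, p0, p1]
    else if s \<in> x ` {..<r} then
      (let i = inv_into {..<r} x s in if q \<bullet> y i < q \<bullet> x i then [\<alpha> i, \<beta> i] else [\<beta> i, \<alpha> i])
    else [s])"

definition L' :: "'a list" where "L' = concat (map expand L)"

lemma expand_w [simp]: "expand w = [w, p0, p1]" by (simp add: expand_def)

lemma expand_x [simp]:
  "i < r \<Longrightarrow> expand (x i) = (if q \<bullet> y i < q \<bullet> x i then [\<alpha> i, \<beta> i] else [\<beta> i, \<alpha> i])"
  using x_neq_w[of i] inv_into_f_f[OF inj, of i] by (simp add: expand_def)

lemma expand_other: "s \<noteq> w \<Longrightarrow> s \<notin> x ` {..<r} \<Longrightarrow> expand s = [s]"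
  by (simp add: expand_def)

lemma expand_y [simp]: "i < r \<Longrightarrow> expand (y i) = [y i]" and expand_z [simp]: "i < r \<Longrightarrow> expand (z i) = [z i]"
  using expand_other y_other z_other by auto

lemma L_cases:
  assumes "s \<in> set L"
  obtains (w) "s = w" | (x) i where "i < r" "s = x i" | (other) "s \<noteq> w" "s \<notin> x ` {..<r}" "expand s = [s]" "0 < C.h s"
  using assms expand_other h_other by blast

lemma new_edges:
  "closed_segment w p0 edge_of C.Q" "closed_segment p1 w edge_of C.Q"
  "closed_segment p0 p1 edge_of C.Q"
  "i < r \<Longrightarrow> closed_segment (\<alpha> i) (\<beta> i) edge_of C.Q" "i < r \<Longrightarrow> closed_segment (\<beta> i) (\<alpha> i) edge_of C.Q"
  "i < r \<Longrightarrow> closed_segment (\<alpha> i) (y i) edge_of C.Q" "i < r \<Longrightarrow> closed_segment (y i) (\<alpha> i) edge_of C.Q"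
  "i < r \<Longrightarrow> closed_segment (\<beta> i) (z i) edge_of C.Q" "i < r \<Longrightarrow> closed_segment (z i) (\<beta> i) edge_of C.Q"
  "closed_segment p1 (\<beta> (r - 1)) edge_of C.Q" "closed_segment (\<alpha> 0) p0 edge_of C.Q"
proof -
  note e0 = edges(1) h_x[OF r0] h_w and e1 = edges(2) h_x[OF r1] h_w
  show "closed_segment w p0 edge_of C.Q" "closed_segment p1 w edge_of C.Q"
    using C.edge_crossing[OF e0] C.edge_crossing[OF e1]
    by (simp_all only: p0_def p1_def closed_segment_commute[of w])
  show "closed_segment p0 p1 edge_of C.Q"
    using C.edge_in_hyp[OF faces(1) dims(1) in_A(2)[OF r0] in_A(1) in_A(2)[OF r1] in_A(1) e0 e1] new_neq(1)
    by (simp add: p0_def p1_def)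
  show ab: "closed_segment (\<alpha> i) (\<beta> i) edge_of C.Q" if i: "i < r" for i
    using C.edge_in_hyp[OF faces(6)[OF i] dims(6)[OF i] in_R(1)[OF i] in_R(2)[OF i] in_R(1)[OF i] in_R(3)[OF i]
        edges(3)[OF i] h_x[OF i] h_y[OF i] edges(4)[OF i] h_x[OF i] h_z[OF i]] new_neq(15)[OF i i]
    by (simp add: \<alpha>_def \<beta>_def)
  show "closed_segment (\<beta> i) (\<alpha> i) edge_of C.Q" if i: "i < r" for i
    using ab[OF i] by (simp add: closed_segment_commute)
  show ay: "closed_segment (\<alpha> i) (y i) edge_of C.Q" if i: "i < r" for i
    using C.edge_crossing[OF edges(3)[OF i] h_x[OF i] h_y[OF i]] by (simp add: \<alpha>_def)
  show "closed_segment (y i) (\<alpha> i) edge_of C.Q" if i: "i < r" for i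
    using ay[OF i] by (simp add: closed_segment_commute)
  show bz: "closed_segment (\<beta> i) (z i) edge_of C.Q" if i: "i < r" for i
    using C.edge_crossing[OF edges(4)[OF i] h_x[OF i] h_z[OF i]] by (simp add: \<beta>_def)
  show "closed_segment (z i) (\<beta> i) edge_of C.Q" if i: "i < r" for i
    using bz[OF i] by (simp add: closed_segment_commute)
  show "closed_segment p1 (\<beta> (r - 1)) edge_of C.Q"
    using C.edge_in_hyp[OF faces(3) dims(3) in_W(2) in_W(1) in_W(2) in_W(3) e1
        edges(4)[OF r1] h_x[OF r1] h_z[OF r1]] new_neq(14)[OF r1]
    by (simp add: p1_def \<beta>_def)
  show "closed_segment (\<alpha> 0) p0 edge_of C.Q"
    using C.edge_in_hyp[OF faces(4) dims(4) in_V(2) in_V(3) in_V(2) in_V(1)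
        edges(3)[OF r0] h_x[OF r0] h_y[OF r0] e0] new_neq(7)[OF r0]
    by (simp add: p0_def \<alpha>_def)
qed

abbreviation "link' \<equiv> link C.Q q p0 x' y' z' (Suc r)"

lemma y'_below: "i < r \<Longrightarrow> q \<bullet> \<beta> i < q \<bullet> \<alpha> i \<longleftrightarrow> \<not> q \<bullet> y i < q \<bullet> x i"
  using q_new(4)[of i] by (auto split: if_splits)

lemma link'_iff: "link' s s' \<longleftrightarrow> closed_segment s s' edge_of C.Q \<and> q \<bullet> s < q \<bullet> s' \<and>
   (s = p0 \<longleftrightarrow> s' = p1) \<and> (s = p1 \<longrightarrow> s' = \<beta> (r - 1)) \<and>
   (\<forall>i<r. s = \<alpha> i \<longrightarrow> s' = (if q \<bullet> y i < q \<bullet> x i then \<beta> i else y i)) \<and>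
   (\<forall>i<r. s' = \<alpha> i \<longrightarrow> s = (if q \<bullet> y i < q \<bullet> x i then y i else \<beta> i))"
proof -
  have last: "\<not> q \<bullet> \<beta> (r - 1) < q \<bullet> p1" using q_new(3)[OF r1] by simp
  have old_values: "x' i = \<alpha> i" "y' i = \<beta> i" "z' i = y i" if "i < r" for i
    using that by (simp_all add: x'_def y'_def z'_def)
  have at_r: "x' r = p1" "y' r = \<beta> (r - 1)" by (simp_all add: x'_def y'_def)
  have out: "(\<forall>i<Suc r. s = x' i \<longrightarrow> s' = (if q \<bullet> y' i < q \<bullet> x' i then z' i else y' i)) \<longleftrightarrow>
    (s = p1 \<longrightarrow> s' = \<beta> (r - 1)) \<and>
    (\<forall>i<r. s = \<alpha> i \<longrightarrow> s' = (if q \<bullet> y i < q \<bullet> x i then \<beta> i else y i))"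
    unfolding All_less_Suc at_r by (simp only: last if_False) (auto simp: old_values y'_below)
  have into: "(\<forall>i<Suc r - 1. s' = x' i \<longrightarrow> s = (if q \<bullet> y' i < q \<bullet> x' i then y' i else z' i)) \<longleftrightarrow>
    (\<forall>i<r. s' = \<alpha> i \<longrightarrow> s = (if q \<bullet> y i < q \<bullet> x i then y i else \<beta> i))"
    unfolding diff_Suc_1 by (auto simp: old_values y'_below)
  have "Suc r - 1 = r" by simp
  then show ?thesis unfolding link_def out into at_r(1)[symmetric] by simp
qed

text \<open>Every new pair of consecutive vertices either lies inside one expansion or joins the
  expansions of an old pair. In the second case the old edge is kept, or it is shortened at
  the end that is cut off.\<close>

lemma path': "successively link' L'"
  unfolding L'_def
proof (rule successively_concat_map[OF path])
  fix s assume "s \<in> set L"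
  then show "expand s \<noteq> [] \<and> successively link' (expand s)"
  proof (cases rule: L_cases)
    case w
    then show ?thesis
      using new_edges(1,3) q_between(1) q_new(1) by (auto simp: link'_iff new_neq old_neq[OF h_w])
  next
    case (x i)
    then show ?thesis
      using new_edges(4,5)[of i] q_new(4)[of i] \<alpha>_inj by (auto simp: link'_iff new_neq)
  qed simp
next
  fix s s' assume L: "s \<in> set L" "s' \<in> set L" and l: "link P q w x y z r s s'"
  have qs: "q \<bullet> s < q \<bullet> s'" and e: "closed_segment s s' edge_of P"
    and lw: "s = w \<longleftrightarrow> s' = x (r - 1)"
    and out: "\<And>i. i < r \<Longrightarrow> s = x i \<Longrightarrow> s' = (if q \<bullet> y i < q \<bullet> x i then z i else y i)"
    and into: "\<And>i. i < r - 1 \<Longrightarrow> s' = x i \<Longrightarrow> s = (if q \<bullet> y i < q \<bullet> x i then y i else z i)"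
    using l by (auto simp: link_def)
  have old: "link' s s'" if "0 < C.h s" "0 < C.h s'" 
    using that e qs C.edge_pos[OF e] by (auto simp: link'_iff dest: old_neq)
  show "link' (last (expand s)) (hd (expand s'))"
    using L(1)
  proof (cases rule: L_cases)
    case w
    then have s': "s' = x (r - 1)" using lw by simp
    have "\<not> q \<bullet> y (r - 1) < q \<bullet> x (r - 1)" using w_first(3) by simp
    then show ?thesis
      using w s' new_edges(10) q_new(3)[OF r1] r1 by (auto simp: link'_iff new_neq)
  next
    case (x i)
    note out = out[OF x]
    show ?thesis
    proof (cases "q \<bullet> y i < q \<bullet> x i")
      case True
      then have "q \<bullet> x i < q \<bullet> z i" using out qs x by simp
      then show ?thesis
        using True out x new_edges(8)[of i] q_between(5)[of i] h_z[of i]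
        by (auto simp: link'_iff new_neq old_neq)
    next
      case False
      then show ?thesis
        using out x new_edges(6)[of i] q_between(3)[of i] h_y[of i] \<alpha>_inj
        by (auto simp: link'_iff new_neq old_neq)
    qed
  next
    case other
    note o = other
    show ?thesis
      using L(2)
    proof (cases rule: L_cases)
      case w
      then show ?thesis using o old h_w by simp
    next
      case (x i)
      then have "i \<noteq> r - 1" using lw o by auto
      then have i: "i < r - 1" using x by simp
      note into = into[OF i x(2)]
      show ?thesis
      proof (cases "q \<bullet> y i < q \<bullet> x i")
        case True
        then show ?thesis
          using into x new_edges(7)[of i] q_between(2)[of i] h_y[of i] \<alpha>_inj
          by (auto simp: link'_iff new_neq old_neq)
      next
        case False
        then have "q \<bullet> z i < q \<bullet> x i" using into qs x by simp
        then show ?thesis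
          using False into x new_edges(9)[of i] q_between(4)[of i] h_z[of i]
          by (auto simp: link'_iff new_neq old_neq)
      qed
    next
      case other
      then show ?thesis using o old by simp
    qed
  qed
qed

lemma set_L': "set L' = (\<Union>s\<in>set L. set (expand s))"
  by (auto simp: L'_def)

lemma L'_cases:
  assumes "v \<in> set L'"
  obtains (old) "v \<in> set L" "0 < C.h v" | (p0) "v = p0" | (p1) "v = p1"
    | (\<alpha>) i where "i < r" "v = \<alpha> i" | (\<beta>) i where "i < r" "v = \<beta> i"
proof -
  obtain s where s: "s \<in> set L" "v \<in> set (expand s)" using assms set_L' by auto
  show ?thesis
    using s(1)
  proof (cases rule: L_cases)
    case w
    then show ?thesis using s that in_L(1) h_w by auto
  next
    case (x i)
    then show ?thesis using s that by (auto split: if_splits)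
  next
    case other
    then show ?thesis using s that by auto
  qed
qed

lemma in_L': "v \<in> set L \<Longrightarrow> v \<notin> x ` {..<r} \<Longrightarrow> v \<in> set L'" "p0 \<in> set L'" "p1 \<in> set L'"
  "i < r \<Longrightarrow> \<alpha> i \<in> set L'" "i < r \<Longrightarrow> \<beta> i \<in> set L'"
proof -
  show "v \<in> set L'" if "v \<in> set L" "v \<notin> x ` {..<r}"
    using that expand_other[of v] by (cases "v = w") (auto simp: set_L' intro!: bexI[of _ v])
  show "p0 \<in> set L'" "p1 \<in> set L'" using in_L(1) by (auto simp: set_L' intro!: bexI[of _ w])
  show "\<alpha> i \<in> set L'" "\<beta> i \<in> set L'" if "i < r"
    using in_L(2)[OF that] that by (auto simp: set_L' intro!: bexI[of _ "x i"])
qed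

lemma distinct_L: "distinct L"
proof -
  have "successively (\<lambda>s s'. q \<bullet> s < q \<bullet> s') L"
    by (rule successively_mono[OF path]) (simp add: link_def)
  then have "sorted_wrt (\<lambda>s s'. q \<bullet> s < q \<bullet> s') L"
    by (subst (asm) successively_conv_sorted_wrt) (auto simp: transp_def)
  then show ?thesis by (induction L) auto
qed

lemma len': "2 * length L' = Suc r * (Suc r + 3)"
proof -
  have "length L' = (\<Sum>s\<in>set L. length (expand s))"
    unfolding L'_def by (rule length_concat_map_distinct[OF distinct_L])
  also have "\<dots> = (\<Sum>s\<in>set L. 1 + (if s = w then 2 else 0) + (if s \<in> x ` {..<r} then 1 else 0))"
    by (intro sum.cong refl) (auto simp: expand_other w_notin_x)
  also have "\<dots> = (\<Sum>s\<in>set L. 1) + (\<Sum>s\<in>set L. if s = w then 2 else 0)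
      + (\<Sum>s\<in>set L. if s \<in> x ` {..<r} then 1 else 0)"
    by (simp only: sum.distrib)
  also have "\<dots> = card (set L) + 2 + card (set L \<inter> x ` {..<r})"
    using in_L(1) by (simp add: sum.If_cases)
  also have "set L \<inter> x ` {..<r} = x ` {..<r}" using in_L(2) by auto
  also have "card (x ` {..<r}) = r" using card_image[OF inj] by simp
  also have "card (set L) = length L" by (rule distinct_card[OF distinct_L])
  finally show ?thesis using len by (simp add: algebra_simps)
qed

lemma card_facets_at_new:
  assumes "closed_segment u v edge_of P" "v \<in> set L" "C.h u < 0" "0 < C.h v"
  shows "card {G \<in> facets C.Q. C.cr u v \<in> G} \<le> 4"
proof -
  have "card {G \<in> facets P. C.cr u v \<in> G} < card {G \<in> facets P. v \<in> G}"
    using facets_through_edge_point[OF polytope _ assms(1) C.cr_in_segment(1)[OF assms(3,4)]] full dim4 by simp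
  then show ?thesis using C.card_facets_at_cut_le[of "C.cr u v"] card_facets_at[OF assms(2)] assms by simp
qed

lemma card_facets_at':
  assumes "v \<in> set L'"
  shows "card {G \<in> facets C.Q. v \<in> G} \<le> 4"
  using assms
proof (cases rule: L'_cases)
  case old
  then show ?thesis using C.card_facets_at_cut_le[of v] card_facets_at[of v] by simp
next
  case p0
  then show ?thesis using card_facets_at_new[OF edges(1) in_L(1) h_x[OF r0] h_w] by (simp add: p0_def)
next
  case p1
  then show ?thesis using card_facets_at_new[OF edges(2) in_L(1) h_x[OF r1] h_w] by (simp add: p1_def)
next
  case (\<alpha> i)
  note i = \<alpha>(1)
  from \<alpha> show ?thesis
    using card_facets_at_new[OF edges(3) in_L(3) h_x h_y, OF i i i i] by (simp add: \<alpha>_def)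
next
  case (\<beta> i)
  note i = \<beta>(1)
  from \<beta> show ?thesis
    using card_facets_at_new[OF edges(4) in_L(4) h_x h_z, OF i i i i] by (simp add: \<beta>_def)
qed

lemma L'_vertices: "set L' \<subseteq> vertices C.Q"
proof
  fix v assume "v \<in> set L'"
  then show "v \<in> vertices C.Q"
  proof (cases rule: L'_cases)
    case old
    then show ?thesis using C.vertex_pos[of v] L_vertices by auto
  next
    case p0
    then show ?thesis using C.vertex_crossing[OF edges(1) h_x[OF r0] h_w] by (simp add: p0_def)
  next
    case p1
    then show ?thesis using C.vertex_crossing[OF edges(2) h_x[OF r1] h_w] by (simp add: p1_def)
  next
    case (\<alpha> i)
    then show ?thesis using C.vertex_crossing[OF edges(3) h_x h_y, of i] by (simp add: \<alpha>_def)
  next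
    case (\<beta> i)
    then show ?thesis using C.vertex_crossing[OF edges(4) h_x h_z, of i] by (simp add: \<beta>_def)
  qed
qed

lemma A'_vertices: "F \<inter> C.hyp \<inter> set L' \<subseteq> insert p0 (x' ` {..<Suc r})"
proof
  fix v assume v: "v \<in> F \<inter> C.hyp \<inter> set L'"
  then have "v \<in> set L'" by simp
  then show "v \<in> insert p0 (x' ` {..<Suc r})"
  proof (cases rule: L'_cases)
    case old
    then show ?thesis using v by (simp add: C.hyp_def)
  next
    case p1
    then show ?thesis by (auto simp: x'_def intro!: image_eqI[of _ _ r])
  next
    case (\<alpha> i)
    then show ?thesis by (auto simp: x'_def intro!: image_eqI[of _ _ i])
  next
    case (\<beta> i)
    then show ?thesis using v new_in(5) by auto
  qed simp
qed

text \<open>Every face of a polytope is exposed.\<close>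

lemma support': "\<exists>c d. (\<forall>p\<in>F \<inter> C.hyp. c \<bullet> p = d) \<and> (\<forall>v\<in>set L'. v \<notin> F \<inter> C.hyp \<longrightarrow> d < c \<bullet> v)"
proof -
  have "(F \<inter> C.hyp) exposed_face_of C.Q"
    using C.face_hyp[OF faces(2)] exposed_face_of_polyhedron[OF polytope_imp_polyhedron[OF C.polytope_Q]] by blast
  then obtain u t where ut: "C.Q \<subseteq> {x. u \<bullet> x \<le> t}" "F \<inter> C.hyp = C.Q \<inter> {x. u \<bullet> x = t}"
    unfolding exposed_face_of_def by blast
  have "u \<bullet> v < t" if "v \<in> set L'" "v \<notin> F \<inter> C.hyp" for v
  proof -
    have "v \<in> C.Q" using that(1) L'_vertices by (auto simp: vertices_def extreme_point_of_def)
    then have "u \<bullet> v \<le> t" "u \<bullet> v \<noteq> t" using that(2) ut by auto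
    then show ?thesis by simp
  qed
  then show ?thesis using ut(2) by (intro exI[of _ "- u"] exI[of _ "- t"]) auto
qed

lemma sewing_next: "\<exists>c d. sewing C.Q q L' (Suc r) p0 x' y' z' (F \<inter> C.hyp) (P \<inter> C.hyp) (A \<inter> C.pos)
    (T \<inter> C.hyp) (T \<inter> C.pos) R' c d"
proof -
  obtain c' d' where sup: "\<And>p. p \<in> F \<inter> C.hyp \<Longrightarrow> c' \<bullet> p = d'"
    "\<And>v. v \<in> set L' \<Longrightarrow> v \<notin> F \<inter> C.hyp \<Longrightarrow> d' < c' \<bullet> v"
    using support' by blast
  have hyps: "p0 \<in> C.hyp" "p1 \<in> C.hyp" "i < r \<Longrightarrow> \<alpha> i \<in> C.hyp" "i < r \<Longrightarrow> \<beta> i \<in> C.hyp" for i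
    by (auto simp: C.hyp_def)
  have poss: "p0 \<in> C.pos" "p1 \<in> C.pos" "i < r \<Longrightarrow> \<alpha> i \<in> C.pos" "i < r \<Longrightarrow> \<beta> i \<in> C.pos"
    "w \<in> C.pos" "i < r \<Longrightarrow> y i \<in> C.pos" for i
    using h_w h_y[of i] by (auto simp: C.pos_def)
  have P: "P face_of P" by (rule face_of_refl[OF C.convex_P])
  have wF: "w \<in> F" using in_A(1) A_sub_F by blast
  have wP: "w \<in> P" by (rule C.x0(1))
  have r'1: "Suc r - 1 = r" by simp
  have y'_notin: "y' i \<notin> F" if "i < Suc r" for i using that new_in(5) r1 by (auto simp: y'_def)
  have z'_notin: "z' i \<notin> C.hyp" if "i < Suc r" for i
    using that h_w h_y[of i] by (auto simp: z'_def C.hyp_def)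
  have y'_L: "y' i \<in> set L'" if "i < Suc r" for i using that in_L'(5) r1 by (auto simp: y'_def)
  have z'_L: "z' i \<in> set L'" if "i < Suc r" for i
    using that in_L'(1) in_L y_other(1) x_neq_w by (auto simp: z'_def)
  have x'_q: "q \<bullet> p1 \<le> q \<bullet> x' i" if "i < Suc r" for i
    using that q_new(2)[of i] by (auto simp: x'_def)
  have below: "q \<bullet> y' i < q \<bullet> x' i \<longleftrightarrow> i < r \<and> \<not> q \<bullet> y i < q \<bullet> x i" if "i < Suc r" for i
    using that y'_below[of i] q_new(3)[OF r1] by (auto simp: x'_def y'_def)
  have order: "q \<bullet> y' i < q \<bullet> x' i \<and> q \<bullet> x' i < q \<bullet> z' i \<or> q \<bullet> z' i < q \<bullet> x' i \<and> q \<bullet> x' i < q \<bullet> y' i"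
    if i: "i < Suc r" for i
  proof (cases "i < r")
    case True
    then show ?thesis using q_new(4)[of i] q_between(2,3)[of i]
      by (auto simp: x'_def y'_def z'_def split: if_splits)
  next
    case False
    then show ?thesis using q_new(1) q_new(3)[OF r1] q_between(1) by (auto simp: x'_def y'_def z'_def)
  qed
  have cr_in: "C.cr u v \<in> G" if "G face_of P" "u \<in> G" "v \<in> G" "C.h u < 0" "0 < C.h v" for G u v
    using cr_in_convex that by blast
  have "sewing C.Q q L' (Suc r) p0 x' y' z' (F \<inter> C.hyp) (P \<inter> C.hyp) (A \<inter> C.pos)
    (T \<inter> C.hyp) (T \<inter> C.pos) R' c' d'"
  proof
    show "DIM('a) = 4" by (rule dim4)
    show "polytope C.Q" by (rule C.polytope_Q)
    show "aff_dim C.Q = int DIM('a)" by (rule C.full_Q)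
    show "card (facets C.Q) \<le> Suc r + 3" using C.card_facets_cut_le card_facets by simp
    show "card {G \<in> facets C.Q. v \<in> G} \<le> 4" if "v \<in> set L'" for v by (rule card_facets_at'[OF that])
    show "2 \<le> Suc r" using r by simp
    show "F \<inter> C.hyp face_of C.Q" "P \<inter> C.hyp face_of C.Q" "A \<inter> C.pos face_of C.Q"
      "T \<inter> C.hyp face_of C.Q" "T \<inter> C.pos face_of C.Q"
      by (rule C.face_hyp[OF faces(2)] C.face_hyp[OF P] C.face_pos[OF faces(1)]
          C.face_hyp[OF faces(5)] C.face_pos[OF faces(5)])+
    show "R' i face_of C.Q" if "i < Suc r" for i
      using C.face_pos[OF faces(6)[of i]] C.face_pos[OF faces(3)] by (simp add: R'_def)
    show "aff_dim (F \<inter> C.hyp) \<le> 2" using C.aff_dim_hyp[OF faces(2) wF h_w] dims(2) by simp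
    show "aff_dim (P \<inter> C.hyp) \<le> 3" using C.aff_dim_hyp[OF P wP h_w] full dim4 by simp
    show "aff_dim (A \<inter> C.pos) \<le> 2" using dims(1) aff_dim_subset[of "A \<inter> C.pos" A] by simp
    show "aff_dim (T \<inter> C.hyp) \<le> 2" using C.aff_dim_hyp[OF faces(5) in_T(1) h_w] dims(5) by simp
    show "aff_dim (T \<inter> C.pos) \<le> 3" using dims(5) aff_dim_subset[of "T \<inter> C.pos" T] by simp
    show "aff_dim (R' i) \<le> 2" if "i < Suc r" for i
      using dims(6)[of i] dims(3) aff_dim_subset[of "R i \<inter> C.pos" "R i"] aff_dim_subset[of "W \<inter> C.pos" W]
      by (auto simp: R'_def)
    show "F \<inter> C.hyp \<subseteq> P \<inter> C.hyp" using face_of_imp_subset[OF faces(2)] by blast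
    show "p0 \<in> F \<inter> C.hyp" using new_in(1) A_sub_F hyps by blast
    show "x' i \<in> F \<inter> C.hyp" if "i < Suc r" for i
      using new_in(2,3) A_sub_F hyps by (auto simp: x'_def)
    show "p0 \<in> A \<inter> C.pos" "x' (Suc r - 1) \<in> A \<inter> C.pos" "z' (Suc r - 1) \<in> A \<inter> C.pos"
      using new_in(1,2) in_A(1) poss by (auto simp: x'_def z'_def)
    have T: "p0 \<in> T" "\<alpha> 0 \<in> T" "\<beta> 0 \<in> T" unfolding p0_def \<alpha>_def \<beta>_def
      using cr_in[OF faces(5)] in_T h_x[OF r0] h_w h_y[OF r0] h_z[OF r0] by auto
    show "p0 \<in> T \<inter> C.hyp" "x' 0 \<in> T \<inter> C.hyp" "y' 0 \<in> T \<inter> C.hyp"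
      using T hyps r0 by (auto simp: x'_def y'_def)
    show "p0 \<in> T \<inter> C.pos" "x' 0 \<in> T \<inter> C.pos" "y' 0 \<in> T \<inter> C.pos" "z' 0 \<in> T \<inter> C.pos"
      using T poss r0 in_T by (auto simp: x'_def y'_def z'_def)
    have RR: "\<alpha> i \<in> R i" "\<beta> i \<in> R i" if "i < r" for i unfolding \<alpha>_def \<beta>_def
      using cr_in[OF faces(6)[OF that]] in_R[OF that] h_x[OF that] h_y[OF that] h_z[OF that] by auto
    have WW: "p1 \<in> W" "\<beta> (r - 1) \<in> W" unfolding p1_def \<beta>_def
      using cr_in[OF faces(3)] in_W h_x[OF r1] h_w h_z[OF r1] by auto
    show "x' i \<in> R' i" "y' i \<in> R' i" "z' i \<in> R' i" if "i < Suc r" for i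
      using RR WW in_W in_R poss r1 by (auto simp: x'_def y'_def z'_def R'_def)
    show "y' i \<in> P \<inter> C.hyp" if "i < Suc r" for i
    proof -
      have "y' i \<in> P"
        using y'_L[OF that] L'_vertices by (auto simp: vertices_def extreme_point_of_def C.Q_def)
      then show ?thesis using hyps r1 by (auto simp: y'_def)
    qed
    show "y' i \<notin> F \<inter> C.hyp" if "i < Suc r" for i using y'_notin[OF that] by blast
    show "z' i \<notin> P \<inter> C.hyp" if "i < Suc r" for i using z'_notin[OF that] by blast
    show "inj_on x' {..<Suc r}"
      by (rule inj_onI) (auto simp: x'_def \<alpha>_inj new_neq split: if_splits)
    show "x' i \<noteq> p0" if "i < Suc r" for i by (auto simp: x'_def new_neq)
    show "closed_segment (x' 0) p0 edge_of C.Q" using new_edges(11) r0 by (simp add: x'_def)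
    show "closed_segment (x' (Suc r - 1)) p0 edge_of C.Q"
      using new_edges(3) by (simp add: x'_def closed_segment_commute)
    show "closed_segment (x' i) (y' i) edge_of C.Q" if "i < Suc r" for i
      using new_edges(4)[of i] new_edges(10) by (auto simp: x'_def y'_def)
    show "closed_segment (x' i) (z' i) edge_of C.Q" if "i < Suc r" for i
      using new_edges(6)[of i] new_edges(2) by (auto simp: x'_def z'_def)
    show "set L' \<subseteq> vertices C.Q" by (rule L'_vertices)
    show "p0 \<in> set L'" by (rule in_L'(2))
    show "x' i \<in> set L'" if "i < Suc r" for i using in_L'(3,4) by (simp add: x'_def)
    show "y' i \<in> set L'" if "i < Suc r" for i by (rule y'_L[OF that])
    show "z' i \<in> set L'" if "i < Suc r" for i by (rule z'_L[OF that])
    show "F \<inter> C.hyp \<inter> set L' \<subseteq> insert p0 (x' ` {..<Suc r})" by (rule A'_vertices)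
    show "c' \<bullet> p = d'" if "p \<in> F \<inter> C.hyp" for p by (rule sup(1)[OF that])
    show "d' < c' \<bullet> v" if "v \<in> set L'" "v \<notin> F \<inter> C.hyp" for v by (rule sup(2)[OF that])
    show "q \<bullet> p0 < q \<bullet> x' i" if "i < Suc r" for i using x'_q[OF that] q_new(1) by simp
    show "q \<bullet> z' (Suc r - 1) < q \<bullet> p0" using q_between(1) by (simp add: z'_def)
    show "q \<bullet> x' (Suc r - 1) < q \<bullet> y' (Suc r - 1)" using q_new(3)[OF r1] by (simp add: x'_def y'_def)
    show "if q \<bullet> y' i < q \<bullet> x' i
      then (q \<bullet> y' i - q \<bullet> x' i) * (c' \<bullet> z' i - d') < (q \<bullet> z' i - q \<bullet> x' i) * (c' \<bullet> y' i - d')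
      else q \<bullet> x' i < q \<bullet> y' i \<and>
        (q \<bullet> z' i - q \<bullet> x' i) * (c' \<bullet> y' i - d') < (q \<bullet> y' i - q \<bullet> x' i) * (c' \<bullet> z' i - d')"
      if i: "i < Suc r" for i
    proof -
      have gy: "0 < c' \<bullet> y' i - d'" using sup(2)[OF y'_L[OF i]] y'_notin[OF i] by simp
      have gz: "0 < c' \<bullet> z' i - d'" using sup(2)[OF z'_L[OF i]] z'_notin[OF i] by simp
      have signs: "s * gz' < t * gy'" if "s < 0" "0 < t" "0 < gz'" "0 < gy'" for s t gz' gy' :: real
      proof -
        have "s * gz' < 0" using that by (simp add: mult_neg_pos)
        also have "0 < t * gy'" using that by simp
        finally show ?thesis .
      qed
      show ?thesis using order[OF i] gy gz by (auto intro!: signs)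
    qed
    show "successively link' L'" by (rule path')
    show "2 * length L' = Suc r * (Suc r + 3)" by (rule len')
  qed
  then show ?thesis by blast
qed

end

section \<open>The simplex\<close>

locale affine_simplex =
  fixes S :: "'a::euclidean_space set"
  assumes indep: "\<not> affine_dependent S"
begin

lemma finite_S: "finite S" by (rule aff_independent_finite[OF indep])

lemma face_hull: "C \<subseteq> S \<Longrightarrow> convex hull C face_of convex hull S"
  using face_of_convex_hull_affine_independent[OF indep] by blast

lemma mem_hull_iff: "v \<in> S \<Longrightarrow> C \<subseteq> S \<Longrightarrow> v \<in> convex hull C \<longleftrightarrow> v \<in> C"
proof
  assume v: "v \<in> S" and C: "C \<subseteq> S" and h: "v \<in> convex hull C"
  show "v \<in> C"
  proof (rule ccontr)
    assume "v \<notin> C"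
    then have "convex hull C \<subseteq> affine hull (S - {v})"
      using C convex_hull_subset_affine_hull[of "S - {v}"] hull_mono[of C "S - {v}" convex] by blast
    then show False using h v indep by (auto simp: affine_dependent_def)
  qed
qed (simp add: hull_inc)

lemma aff_dim_hull_le: "C \<subseteq> S \<Longrightarrow> aff_dim (convex hull C) \<le> int (card C) - 1"
  using aff_dim_le_card[of C] finite_subset[OF _ finite_S] by (simp add: aff_dim_convex_hull)

lemma segment_edge:
  assumes "u \<in> S" "v \<in> S" "u \<noteq> v"
  shows "closed_segment u v edge_of convex hull S"
  using face_hull[of "{u, v}"] aff_dim_closed_segment[OF assms(3)] assms
  by (simp add: edge_of_def segment_convex_hull)

lemma vertices_hull: "vertices (convex hull S) = S"
  unfolding vertices_def using extreme_point_of_convex_hull_affine_independent[OF indep] by blast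

lemma facets_subset: "facets (convex hull S) \<subseteq> (\<lambda>u. convex hull (S - {u})) ` S"
  using facet_of_convex_hull_affine_independent[OF indep] by (auto simp: facets_def)

lemma card_facets_le: "card (facets (convex hull S)) \<le> card S"
  by (rule surj_card_le[OF finite_S facets_subset])

lemma card_facets_at_le:
  assumes "v \<in> S"
  shows "card {G \<in> facets (convex hull S). v \<in> G} \<le> card S - 1"
proof -
  have "{G \<in> facets (convex hull S). v \<in> G} \<subseteq> (\<lambda>u. convex hull (S - {u})) ` (S - {v})"
  proof
    fix G assume G: "G \<in> {G \<in> facets (convex hull S). v \<in> G}"
    then obtain u where u: "u \<in> S" "G = convex hull (S - {u})" using facets_subset by blast
    then have "u \<noteq> v" using G mem_hull_iff[OF assms, of "S - {u}"] by blast
    then show "G \<in> (\<lambda>u. convex hull (S - {u})) ` (S - {v})" using u by blast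
  qed
  then have "card {G \<in> facets (convex hull S). v \<in> G} \<le> card (S - {v})"
    by (intro surj_card_le) (simp_all add: finite_S)
  then show ?thesis using assms by (simp add: card_Diff_singleton finite_S)
qed

end

text \<open>The vertices in path order are $0, e_1, e_2, e_3, e_4$ at heights 0 to 4, with $w = e_1$,
  $x_1 = e_2$, $x_0 = e_4$, $y = e_3$ and $z = 0$. The path ends in $x_0$, so $\alpha_0$ must come before $\beta_0$
  although both neighbours of $x_0$ are below it. This is arranged by letting the supporting
  functional take the value 1 at $e_3$ and 5 at $0$: the rates are then $(3 - 4)/1$ and
  $(0 - 4)/5$, and the former is smaller.\<close>

lemma sewing_simplex:
  assumes dim: "DIM('a::euclidean_space) = 4"
  shows "\<exists>(P :: 'a set) q L w x y z A F W V T R c d. sewing P q L 2 w x y z A F W V T R c d"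
proof -
  have "card (Basis :: 'a set) = Suc (Suc (Suc (Suc 0)))" using dim by simp
  then obtain e1 e2 e3 e4 :: 'a where B: "Basis = {e1, e2, e3, e4}"
    and ne: "e1 \<noteq> e2" "e1 \<noteq> e3" "e1 \<noteq> e4" "e2 \<noteq> e3" "e2 \<noteq> e4" "e3 \<noteq> e4"
    by (auto simp: card_Suc_eq)
  have ne': "e2 \<noteq> e1" "e3 \<noteq> e1" "e4 \<noteq> e1" "e3 \<noteq> e2" "e4 \<noteq> e2" "e4 \<noteq> e3" using ne by auto
  have inB: "e1 \<in> Basis" "e2 \<in> Basis" "e3 \<in> Basis" "e4 \<in> Basis" using B by auto
  have nz: "e1 \<noteq> 0" "e2 \<noteq> 0" "e3 \<noteq> 0" "e4 \<noteq> 0" using inB nonzero_Basis by auto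
  have nz': "0 \<noteq> e1" "0 \<noteq> e2" "0 \<noteq> e3" "0 \<noteq> e4" using nz by auto
  have ip: "u \<bullet> v = (if u = v then 1 else 0)" if "u \<in> {e1, e2, e3, e4}" "v \<in> {e1, e2, e3, e4}" for u v
    using inner_Basis[of u v] that B by auto
  define S where "S = {0, e1, e2, e3, e4}"
  have "\<not> affine_dependent S"
  proof -
    have "S = insert 0 Basis" by (simp add: S_def B)
    moreover have "(0::'a) \<notin> Basis" using nonzero_Basis by blast
    ultimately show ?thesis
      using affine_dependent_iff_dependent[of 0 "Basis :: 'a set"] independent_Basis by simp
  qed
  then interpret affine_simplex S by unfold_locales
  have card_S: "card S = 5" using ne nz' by (simp add: S_def)
  define q where "q = e1 + 2 *\<^sub>R e2 + 3 *\<^sub>R e3 + 4 *\<^sub>R e4"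
  define c where "c = (- 5) *\<^sub>R e1 + (- 5) *\<^sub>R e2 + (- 4) *\<^sub>R e3 + (- 5) *\<^sub>R e4"
  have q: "q \<bullet> 0 = 0" "q \<bullet> e1 = 1" "q \<bullet> e2 = 2" "q \<bullet> e3 = 3" "q \<bullet> e4 = 4"
    using ne ne' by (simp_all add: q_def inner_add_left ip)
  have c: "c \<bullet> 0 = 0" "c \<bullet> e1 = - 5" "c \<bullet> e2 = - 5" "c \<bullet> e3 = - 4" "c \<bullet> e4 = - 5"
    using ne ne' by (simp_all add: c_def inner_add_left inner_diff_left ip)
  define x where "x i = (if i = 0 then e4 else e2)" for i :: nat
  define y where "y i = e3" for i :: nat
  define z where "z i = (0::'a)" for i :: nat
  let ?A = "{e1, e2, e4}" and ?F = "{e1, e2, e3, e4}" and ?W = "{e1, e2, 0}" and ?V = "{e1, e3, e4}"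
    and ?T = "{e1, e3, e4, 0}" and ?R = "\<lambda>i. {x i, e3, 0}"
  have sub: "?A \<subseteq> S" "?F \<subseteq> S" "?W \<subseteq> S" "?V \<subseteq> S" "?T \<subseteq> S" "?R i \<subseteq> S" for i
    by (auto simp: S_def x_def)
  have inS: "0 \<in> S" "e1 \<in> S" "e2 \<in> S" "e3 \<in> S" "e4 \<in> S" by (auto simp: S_def)
  have xS: "x i \<in> S" for i by (simp add: x_def inS)
  have card_le: "card {u1, u2, u3} \<le> 3" "card {u1, u2, u3, u4} \<le> 4" for u1 u2 u3 u4 :: 'a
    by (simp_all add: card_insert_if)
  have dim3: "aff_dim (convex hull {u1, u2, u3}) \<le> 2" if "{u1, u2, u3} \<subseteq> S" for u1 u2 u3
    using aff_dim_hull_le[OF that] card_le(1)[of u1 u2 u3] by linarith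
  have dim4: "aff_dim (convex hull {u1, u2, u3, u4}) \<le> 3" if "{u1, u2, u3, u4} \<subseteq> S" for u1 u2 u3 u4
    using aff_dim_hull_le[OF that] card_le(2)[of u1 u2 u3 u4] by linarith
  have supp_A: "convex hull ?A \<subseteq> {p. c \<bullet> p = - 5}"
    by (rule hull_minimal) (auto simp: c convex_hyperplane)
  have "sewing (convex hull S) q [0, e1, e2, e3, e4] 2 e1 x y z (convex hull ?A) (convex hull ?F)
    (convex hull ?W) (convex hull ?V) (convex hull ?T) (\<lambda>i. convex hull (?R i)) c (- 5)"
  proof
    show "DIM('a) = 4" by (rule dim)
    show "polytope (convex hull S)" by (rule polytope_convex_hull[OF finite_S])
    show "aff_dim (convex hull S) = int DIM('a)"
      using aff_dim_affine_independent[OF indep] card_S dim by (simp add: aff_dim_convex_hull)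
    show "card (facets (convex hull S)) \<le> 2 + 3" using card_facets_le card_S by simp
    show "card {G \<in> facets (convex hull S). v \<in> G} \<le> 4" if "v \<in> set [0, e1, e2, e3, e4]" for v
      using card_facets_at_le[of v] that card_S by (auto simp: S_def)
    show "convex hull ?A face_of convex hull S" "convex hull ?F face_of convex hull S"
      "convex hull ?W face_of convex hull S" "convex hull ?V face_of convex hull S"
      "convex hull ?T face_of convex hull S" "convex hull (?R i) face_of convex hull S" for i
      by (rule face_hull[OF sub(1)] face_hull[OF sub(2)] face_hull[OF sub(3)] face_hull[OF sub(4)]
          face_hull[OF sub(5)] face_hull[OF sub(6)])+
    show "aff_dim (convex hull ?A) \<le> 2" "aff_dim (convex hull ?W) \<le> 2" "aff_dim (convex hull ?V) \<le> 2"
      "aff_dim (convex hull (?R i)) \<le> 2" for i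
      by (rule dim3[OF sub(1)] dim3[OF sub(3)] dim3[OF sub(4)] dim3[OF sub(6)])+
    show "aff_dim (convex hull ?F) \<le> 3" "aff_dim (convex hull ?T) \<le> 3"
      by (rule dim4[OF sub(2)] dim4[OF sub(5)])+
    show "convex hull ?A \<subseteq> convex hull ?F" by (rule hull_mono) auto
    show "x i \<in> convex hull ?A" for i by (simp add: x_def hull_inc)
    show "x (2 - 1) \<in> convex hull ?W" "z (2 - 1) \<in> convex hull ?W" by (simp_all add: x_def z_def hull_inc)
    show "x 0 \<in> convex hull ?V" "y 0 \<in> convex hull ?V" "x 0 \<in> convex hull ?T" "y 0 \<in> convex hull ?T"
      "z 0 \<in> convex hull ?T" by (simp_all add: x_def y_def z_def hull_inc)
    show "x i \<in> convex hull (?R i)" "y i \<in> convex hull (?R i)" "z i \<in> convex hull (?R i)" for i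
      by (simp_all add: y_def z_def hull_inc)
    show "y i \<in> convex hull ?F" for i by (simp add: y_def hull_inc)
    show "y i \<notin> convex hull ?A" for i using mem_hull_iff[OF inS(4) sub(1)] ne ne' by (simp add: y_def)
    show "z i \<notin> convex hull ?F" for i using mem_hull_iff[OF inS(1) sub(2)] nz' by (simp add: z_def)
    show "inj_on x {..<2}" using ne' by (auto simp: inj_on_def x_def less_2_cases_iff)
    show "x i \<noteq> e1" for i using ne' by (simp add: x_def)
    show "closed_segment (x 0) e1 edge_of convex hull S" "closed_segment (x (2 - 1)) e1 edge_of convex hull S"
      using segment_edge[OF inS(5) inS(2)] segment_edge[OF inS(3) inS(2)] ne' by (simp_all add: x_def)
    show "closed_segment (x i) (y i) edge_of convex hull S" "closed_segment (x i) (z i) edge_of convex hull S" for i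
      using segment_edge[OF xS inS(4)] segment_edge[OF xS inS(1)] ne ne' nz
      by (auto simp: x_def y_def z_def)
    show "set [0, e1, e2, e3, e4] \<subseteq> vertices (convex hull S)"
      unfolding vertices_hull by (simp add: S_def)
    show "x i \<in> set [0, e1, e2, e3, e4]" "y i \<in> set [0, e1, e2, e3, e4]" "z i \<in> set [0, e1, e2, e3, e4]" for i
      by (simp_all add: x_def y_def z_def)
    show "convex hull ?A \<inter> set [0, e1, e2, e3, e4] \<subseteq> insert e1 (x ` {..<2})"
    proof
      fix v assume v: "v \<in> convex hull ?A \<inter> set [0, e1, e2, e3, e4]"
      then have "v \<in> ?A" using mem_hull_iff[OF _ sub(1), of v] by (simp add: S_def)
      moreover have "x 0 = e4" "x 1 = e2" by (simp_all add: x_def)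
      moreover have "x 0 \<in> x ` {..<2}" "x 1 \<in> x ` {..<2}" by (rule imageI, simp)+
      ultimately show "v \<in> insert e1 (x ` {..<2})" by auto
    qed
    show "c \<bullet> p = - 5" if "p \<in> convex hull ?A" for p using supp_A that by blast
    show "- 5 < c \<bullet> v" if "v \<in> set [0, e1, e2, e3, e4]" "v \<notin> convex hull ?A" for v
    proof -
      have "v \<notin> ?A" using that(2) hull_inc[of v ?A convex] by blast
      then have "v = 0 \<or> v = e3" using that(1) by auto
      then show ?thesis using c by auto
    qed
    show "q \<bullet> e1 < q \<bullet> x i" for i by (simp add: x_def q)
    show "q \<bullet> z (2 - 1) < q \<bullet> e1" "q \<bullet> x (2 - 1) < q \<bullet> y (2 - 1)" by (simp_all add: x_def y_def z_def q)
    show "if q \<bullet> y i < q \<bullet> x i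
      then (q \<bullet> y i - q \<bullet> x i) * (c \<bullet> z i - - 5) < (q \<bullet> z i - q \<bullet> x i) * (c \<bullet> y i - - 5)
      else q \<bullet> x i < q \<bullet> y i \<and>
        (q \<bullet> z i - q \<bullet> x i) * (c \<bullet> y i - - 5) < (q \<bullet> y i - q \<bullet> x i) * (c \<bullet> z i - - 5)" for i
      by (simp add: x_def y_def z_def q c)
    have "link (convex hull S) q e1 x y z 2 0 e1" "link (convex hull S) q e1 x y z 2 e1 e2"
      "link (convex hull S) q e1 x y z 2 e2 e3" "link (convex hull S) q e1 x y z 2 e3 e4"
      unfolding link_def using segment_edge inS ne ne' nz nz' by (auto simp: x_def y_def z_def q)
    then show "successively (link (convex hull S) q e1 x y z 2) [0, e1, e2, e3, e4]" by simp
  qed (simp_all add: hull_inc)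
  then show ?thesis by blast
qed

section \<open>Extremality of the constructed polytopes\<close>

lemma sewing_exists:
  assumes dim: "DIM('a::euclidean_space) = 4"
  shows "\<exists>(P :: 'a set) q L w x y z A F W V T R c d. sewing P q L (m + 2) w x y z A F W V T R c d"
proof (induction m)
  case 0
  show ?case unfolding add_0 by (rule sewing_simplex[OF dim])
next
  case (Suc m)
  then obtain P :: "'a set" and q L w x y z A F W V T R c d
    where s: "sewing P q L (m + 2) w x y z A F W V T R c d" by blast
  obtain a b where ab: "sewing.cutting q L (m + 2) w x y z a b"
    using sewing.cutting_hyperplane_exists[OF s] by blast
  interpret sewing_step P q L "m + 2" w x y z A F W V T R c d a b
    by (rule sewing_step.intro[OF s]) (unfold_locales, rule ab)
  show ?case using sewing_next by (simp, blast)
qed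

context sewing
begin

lemma monotone_path: "monotone_path P (\<lambda>p. q \<bullet> p) L"
proof -
  have "successively (\<lambda>s s'. closed_segment s s' edge_of P) L" "successively (\<lambda>s s'. q \<bullet> s < q \<bullet> s') L"
    by (rule successively_mono[OF path]; simp add: link_def)+
  then show ?thesis using in_L(1) L_vertices by (auto simp: monotone_path_def edge_path_def)
qed

text \<open>A polytope with $k \le r + 3$ facets has at most $\frac12 k (k - 3)$ vertices, and the path already
  visits $\frac12 r (r + 3)$ of them. So $k = r + 3$, the path visits every vertex, and the bound in
  terms of the meeting pairs of facets is attained only if all pairs meet.\<close>

lemma extremal:
  "card (facets P) = r + 3" "set L = vertices P"
  "\<And>S. S \<subseteq> facets P \<Longrightarrow> card S = 2 \<Longrightarrow> \<Inter>S \<noteq> {}"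
proof -
  have d: "aff_dim P = 4" using full dim4 by simp
  define k where "k = card (facets P)"
  have finV: "finite (vertices P)" by (rule finite_vertices[OF polytope])
  have L: "length L = card (set L)"
    using distinct_card[OF monotone_path_distinct[OF monotone_path]] by simp
  have le: "length L \<le> card (vertices P)" unfolding L by (rule card_mono[OF finV L_vertices])
  have ubt: "2 * int (card (vertices P)) \<le> int k * (int k - 3)"
    using vertices_4_polytope_le_ubt[OF polytope d] by (simp add: k_def)
  have "int (r * (r + 3)) \<le> int k * (int k - 3)" using le len ubt by linarith
  then have big: "int r * (int r + 3) \<le> int k * (int k - 3)" by (simp add: algebra_simps)
  have k: "k = r + 3"
  proof (rule ccontr)
    assume "k \<noteq> r + 3"
    then have "int k \<le> int r + 2" using card_facets by (simp add: k_def)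
    then have "int k * (int k - 3) \<le> int k * (int r - 1)" by (intro mult_left_mono) auto
    also have "\<dots> \<le> (int r + 2) * (int r - 1)" using \<open>int k \<le> int r + 2\<close> r by (intro mult_right_mono) auto
    also have "\<dots> < int r * (int r + 3)" using r by (simp add: algebra_simps)
    finally show False using big by simp
  qed
  then show "card (facets P) = r + 3" by (simp add: k_def)
  have "2 * int (card (vertices P)) \<le> 2 * int (length L)"
    using ubt len unfolding k by (simp add: algebra_simps flip: of_nat_mult)
  then have eq: "card (vertices P) = length L" using le by simp
  then show "set L = vertices P" by (intro card_subset_eq[OF finV L_vertices]) (simp add: L)
  show "\<Inter>S \<noteq> {}" if S: "S \<subseteq> facets P" "card S = 2" for S
  proof
    assume empty: "\<Inter>S = {}"
    let ?all = "{S. S \<subseteq> facets P \<and> card S = 2}" and ?meet = "{S. S \<subseteq> facets P \<and> card S = 2 \<and> \<Inter>S \<noteq> {}}"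
    have fin: "finite ?all" by (rule finite_subset[of _ "Pow (facets P)"]) (auto simp: finite_facets polytope)
    have "?meet \<subset> ?all" using S empty by auto
    then have "card ?meet < card ?all" by (rule psubset_card_mono[OF fin])
    also have "\<dots> = k choose 2" unfolding k_def by (rule n_subsets) (simp add: finite_facets polytope)
    finally have "card (vertices P) + k < k choose 2"
      using vertices_4_polytope_le[OF polytope d] by (simp add: k_def)
    then have "2 * (length L + k) < 2 * (k choose 2)" using eq by simp
    also have "\<dots> = k * (k - 1)"
    proof -
      have "even (k * (k - 1))" by auto
      then show ?thesis unfolding choose_two by (rule dvd_mult_div_cancel)
    qed
    finally show False using len by (simp add: k algebra_simps)
  qed
qed

lemma simple: "simple_polytope P"
  unfolding simple_polytope_def
proof (intro conjI ballI polytope)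
  fix v assume v: "v \<in> vertices P"
  have "card {F \<in> facets P. v \<in> F} \<le> 4" using card_facets_at v extremal(2) by blast
  moreover have "aff_dim P \<le> int (card {F \<in> facets P. v \<in> F})"
    using card_facets_at_vertex_ge[OF polytope, of v] v by (simp add: vertices_def facets_def)
  ultimately show "int (card {F \<in> facets P. v \<in> F}) = aff_dim P" using full dim4 by simp
qed

lemma neighborly: "polar_to_neighborly P"
  unfolding polar_to_neighborly_def
proof (intro conjI simple allI impI)
  fix S assume S: "S \<subseteq> facets P" and le: "int (card S) \<le> aff_dim P div 2"
  have "finite S" using S finite_facets[OF polytope] finite_subset by blast
  moreover have "card S \<le> 2" using le full dim4 by simp
  ultimately consider "S = {}" | G where "S = {G}" | "card S = 2"
    by (metis One_nat_def card_1_singletonE card_eq_0_iff le_SucE le_zero_eq numeral_2_eq_2)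
  then show "\<Inter>S \<noteq> {}"
  proof cases
    case 2
    then show ?thesis using S by (auto simp: facets_def facet_of_def)
  qed (use extremal(3)[OF S] in auto)
qed

lemma hamilton: "monotone_hamilton_path P (\<lambda>p. q \<bullet> p) L"
  using monotone_path monotone_path_distinct[OF monotone_path] extremal(2)
  by (simp add: monotone_hamilton_path_def)

end

theorem mainTheorem1:
  shows "(\<forall>m::nat. \<exists>(Q :: (real^4) set) (f :: real^4 \<Rightarrow> real) vs.
            Q \<in> d_polytopes TYPE(4) (m + 5) \<and> polar_to_neighborly Q \<and>
            linear f \<and> monotone_hamilton_path Q f vs)
       \<and> (\<forall>n::nat. n \<ge> 5 \<longrightarrow>
            M_mono TYPE(4) n = M_ubt TYPE(4) n \<and>
            real (M_ubt TYPE(4) n) = 1 / 2 * real n * (real n - 3))"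
proof -
  have ex: "\<exists>(Q :: (real^4) set) (f :: real^4 \<Rightarrow> real) vs.
            Q \<in> d_polytopes TYPE(4) (m + 5) \<and> polar_to_neighborly Q \<and>
            linear f \<and> monotone_hamilton_path Q f vs \<and> 2 * length vs = (m + 2) * (m + 5)" for m
  proof -
    have "DIM(real^4) = 4" by simp
    from sewing_exists[OF this, of m] obtain P :: "(real^4) set" and q L w x y z A F W V T R c d
      where "sewing P q L (m + 2) w x y z A F W V T R c d" by blast
    then interpret sewing P q L "m + 2" w x y z A F W V T R c d .
    have "P \<in> d_polytopes TYPE(4) (m + 5)"
      using polytope full extremal(1) by (simp add: d_polytopes_def)
    moreover have "linear (\<lambda>p. q \<bullet> p)" by (simp add: bounded_linear.linear bounded_linear_inner_right)
    moreover have "2 * length L = (m + 2) * (m + 5)" using len by (simp add: algebra_simps)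
    ultimately show ?thesis using neighborly hamilton by blast
  qed
  have max: "M_mono TYPE(4) n = M_ubt TYPE(4) n \<and>
            real (M_ubt TYPE(4) n) = 1 / 2 * real n * (real n - 3)" if n: "n \<ge> 5" for n
  proof -
    obtain m where m: "n = m + 5" using n by (metis add.commute le_Suc_ex)
    obtain Q :: "(real^4) set" and f :: "real^4 \<Rightarrow> real" and vs
      where Q: "Q \<in> d_polytopes TYPE(4) n" "linear f" "monotone_hamilton_path Q f vs"
        and lv: "2 * length vs = (m + 2) * (m + 5)" using ex[of m] m by blast
    have "2 * int (length vs) = (int m + 2) * (int m + 5)"
      using arg_cong[OF lv, of int] by (simp add: algebra_simps)
    then have len: "2 * int (length vs) = int n * (int n - 3)" by (simp add: m algebra_simps)
    have path: "monotone_path Q f vs" and all: "length vs = card (vertices Q)"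
      using Q(3) distinct_card[of vs] by (auto simp: monotone_hamilton_path_def)
    have bound: "card (vertices P) \<le> length vs" if "P \<in> d_polytopes TYPE(4) n" for P :: "(real^4) set"
      using vertices_4_polytope_le_ubt[of P] that len by (simp add: d_polytopes_def)
    have "M_ubt TYPE(4) n = length vs"
      unfolding M_ubt_def by (rule Max_eqI[OF finite_vertex_numbers]) (use Q(1) all bound in auto)
    moreover have "M_mono TYPE(4) n = length vs"
      unfolding M_mono_def
    proof (rule Max_eqI[OF finite_monotone_path_lengths])
      fix k assume "k \<in> {length us | P f us. P \<in> d_polytopes TYPE(4) n \<and> linear f \<and> monotone_path P f us}"
      then obtain P :: "(real^4) set" and g us where P: "k = length us" "P \<in> d_polytopes TYPE(4) n"
        "monotone_path P g us" by blast
      have "k = card (set us)" using distinct_card[OF monotone_path_distinct[OF P(3)]] P(1) by simp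
      also have "\<dots> \<le> card (vertices P)"
        using P by (intro card_mono finite_vertices) (auto simp: d_polytopes_def monotone_path_def edge_path_def)
      also have "\<dots> \<le> length vs" by (rule bound[OF P(2)])
      finally show "k \<le> length vs" .
    qed (use Q path in blast)
    moreover have "real (length vs) = 1 / 2 * real n * (real n - 3)"
    proof -
      have "real_of_int (2 * int (length vs)) = real_of_int (int n * (int n - 3))" using len by simp
      then show ?thesis by simp
    qed
    ultimately show ?thesis by simp
  qed
  show ?thesis using ex max by blast
qed

end
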